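(* Let $c\in\mathbb{C}$ and $r\ge 0$, and suppose that the interior of the closed disk $\overline{B}(c,r)=\{c'\in\mathbb{C}: |c'-c|\le r\}$ contains a superattracting parameter $\tilde c$. Then the following four statements are equivalent: (1) $r\le r_{\mathrm{bif}}(c)$; (2) for every $\omega\in\Omega_{c,r}$ the orbit $\{f^{(n)}_{\omega}(0)\}_{n\ge1}$ is bounded (hence $T_{c,r}(0)=0$); (3) the random Julia set $J_\omega$ is connected for every $\omega\in\Omega_{c,r}$; (4) the set $\overline{\bigcup_{g\in G_{c,r}}\{g(0)\}}$ is a planar minimal set of $G_{c,r}$. Also, the following four statements are equivalent: (1') $r> r_{\mathrm{bif}}(c)$; (2') for $\mathbb{P}_{c,r}$-almost every $\omega\in\Omega_{c,r}$, $f^{(n)}_{\omega}(0)\to\infty$ as $n\to\infty$, i.e. $T_{c,r}(0)=1$; (3') the random Julia set $J_\omega$ is totally disconnected for $\mathbb{P}_{c,r}$-almost every $\omega\in\Omega_{c,r}$; (4') the set $\overline{\bigcup_{g\in G_{c,r}}\{g(0)\}}$ is not bounded in $\mathbb{C}$. Furthermore, either the first group (1)–(4) or the second group (1')–(4') holds.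
   Context: Throughout, $f_c(z)=z^2+c$ for $c\in\mathbb{C}$, extended to the Riemann sphere $\widehat{\mathbb{C}}$ by $f_c(\infty)=\infty$. A parameter $\tilde c$ is superattracting if $f_{\tilde c}^{\circ p}(0)=0$ for some $p\in\mathbb{N}$. For $\omega=(c_n)_{n\ge1}\in\mathbb{C}^{\mathbb{N}}$ write $f^{(n)}_\omega=f_{c_n}\circ\cdots\circ f_{c_1}$. The random (non-autonomous) Julia set is $J_\omega=\{z\in\mathbb{C}:\{f^{(n)}_\omega\}_{n\ge1}$ is not normal on any neighborhood of $z\}$. For $r>0$ let $\mu_{c,r}$ be the normalized Lebesgue measure on $\overline{B}(c,r)$, and for $r=0$ the Dirac measure at $c$; $\mathbb{P}_{c,r}$ is the infinite product of $\mu_{c,r}$ on $\Omega_{c,r}=\prod_{n\ge1}\overline{B}(c,r)$ (Borel $\sigma$-algebra), and $T_{c,r}(z)=\mathbb{P}_{c,r}(\{\omega: f^{(n)}_\omega(z)\to\infty\})$. $G_{c,r}$ is the semigroup (under composition) generated by $\{f_{c'}:c'\in\overline{B}(c,r)\}$. For a polynomial semigroup $G$, a minimal set is a minimal element, with respect to inclusion, of the family of non-empty compact subsets $L\subset\widehat{\mathbb{C}}$ with $g(L)\subset L$ for all $g\in G$; it is planar if $\infty\notin L$. The bifurcation radius $r_{\mathrm{bif}}(c)$ is the supremum of those $r\ge0$ for which $G_{c,r}$ has a planar minimal set (equivalently the infimum of those $r\ge0$ for which $G_{c,r}$ has no planar minimal set); by prior work this value is attained, $G_{c,r}$ has a planar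 minimal set iff $r\le r_{\mathrm{bif}}(c)$, and $r_{\mathrm{bif}}(c)>0$ iff $f_c$ is hyperbolic with $c$ in the Mandelbrot set. *)

theory Defs
  imports "HOL-Probability.Probability"
begin

definition fq :: "complex \<Rightarrow> complex \<Rightarrow> complex" where
  "fq c z = z ^ 2 + c"

(* Non-autonomous iteration f^{(n)}_omega = f_{c_n} o ... o f_{c_1},
   where the sequence (c_n)_{n>=1} is encoded as omega :: nat => complex with c_{k} = omega (k-1). *)
fun seq_iter :: "(nat \<Rightarrow> complex) \<Rightarrow> nat \<Rightarrow> complex \<Rightarrow> complex" where
  "seq_iter \<omega> 0 = id"
| "seq_iter \<omega> (Suc n) = fq (\<omega> n) \<circ> seq_iter \<omega> n"

definition Omega :: "complex \<Rightarrow> real \<Rightarrow> (nat \<Rightarrow> complex) set" where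
  "Omega c r = {\<omega>. \<forall>n. \<omega> n \<in> cball c r}"

definition mu :: "complex \<Rightarrow> real \<Rightarrow> complex measure" where
  "mu c r = (if r = 0 then return lborel c else uniform_measure lborel (cball c r))"

definition Prob :: "complex \<Rightarrow> real \<Rightarrow> (nat \<Rightarrow> complex) measure" where
  "Prob c r = PiM UNIV (\<lambda>_::nat. mu c r)"

definition T :: "complex \<Rightarrow> real \<Rightarrow> complex \<Rightarrow> real" where
  "T c r z = measure (Prob c r)
     {\<omega> \<in> space (Prob c r). filterlim (\<lambda>n. seq_iter \<omega> n z) at_infinity sequentially}"

(* Normality (on the Riemann sphere) of a family of holomorphic maps on an open set U:
   every sequence in the family has a subsequence converging locally uniformly on U
   either to a (finite) limit function or to the constant infinity. *)
definition normal_family :: "(complex \<Rightarrow> complex) set \<Rightarrow> complex set \<Rightarrow> bool" where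
  "normal_family F U \<longleftrightarrow>
     (\<forall>g::nat \<Rightarrow> complex \<Rightarrow> complex. (\<forall>n. g n \<in> F) \<longrightarrow>
        (\<exists>\<sigma>::nat \<Rightarrow> nat. strict_mono \<sigma> \<and>
           ((\<exists>h. \<forall>K. compact K \<and> K \<subseteq> U \<longrightarrow> uniform_limit K (\<lambda>n. g (\<sigma> n)) h sequentially)
            \<or> (\<forall>K. compact K \<and> K \<subseteq> U \<longrightarrow>
                  (\<forall>M::real. eventually (\<lambda>n. \<forall>z\<in>K. M \<le> norm (g (\<sigma> n) z)) sequentially)))))"

definition julia :: "(nat \<Rightarrow> complex) \<Rightarrow> complex set" where
  "julia \<omega> = {z. \<not> (\<exists>U. open U \<and> z \<in> U \<and> normal_family (range (\<lambda>n. seq_iter \<omega> (Suc n))) U)}"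

definition totally_disconnected :: "'a::topological_space set \<Rightarrow> bool" where
  "totally_disconnected S \<longleftrightarrow> (\<forall>x\<in>S. connected_component_set S x = {x})"

definition superattracting :: "complex \<Rightarrow> bool" where
  "superattracting ct \<longleftrightarrow> (\<exists>p::nat. p \<ge> 1 \<and> (fq ct ^^ p) 0 = 0)"

inductive_set Gsg :: "complex \<Rightarrow> real \<Rightarrow> (complex \<Rightarrow> complex) set" for c r where
  gen: "c' \<in> cball c r \<Longrightarrow> fq c' \<in> Gsg c r"
| comp: "g \<in> Gsg c r \<Longrightarrow> h \<in> Gsg c r \<Longrightarrow> g \<circ> h \<in> Gsg c r"

(* planar minimal set: a minimal nonempty compact G-forward-invariant subset of the sphere
   not containing infinity; such a set is a compact subset of C, and all its
   compact invariant subsets are planar too. *)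
definition planar_minimal_set :: "(complex \<Rightarrow> complex) set \<Rightarrow> complex set \<Rightarrow> bool" where
  "planar_minimal_set G L \<longleftrightarrow>
     L \<noteq> {} \<and> compact L \<and> (\<forall>g\<in>G. g ` L \<subseteq> L) \<and>
     (\<forall>K. K \<subseteq> L \<and> K \<noteq> {} \<and> compact K \<and> (\<forall>g\<in>G. g ` K \<subseteq> K) \<longrightarrow> K = L)"

definition r_bif :: "complex \<Rightarrow> real" where
  "r_bif c = Sup {r. r \<ge> 0 \<and> (\<exists>L. planar_minimal_set (Gsg c r) L)}"

end

theory Submission
  imports Defs "HOL-Complex_Analysis.Complex_Analysis"
begin

text \<open>
  Everything hinges on whether the orbit of \<open>0\<close> under the semigroup is bounded.

  Every nonempty compact invariant set \<open>L\<close> contains \<open>0\<close>. Otherwise \<open>L\<close> has positive distance from the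
  finite orbit of \<open>0\<close> under the superattracting map, so inverse branches of its iterates exist on discs of a
  fixed radius centred in \<open>L\<close>, and the derivatives of the iterates on \<open>L\<close> are bounded below. Perturbing
  all parameters along an orbit at once keeps the orbit in \<open>L\<close>, and the Cauchy estimate bounds the sum
  of these derivatives along the orbit independently of its length, which is absurd.

  If the orbit of \<open>0\<close> is unbounded, then no compact set is invariant, every point escapes with positive
  probability, and by compactness survival probabilities decay geometrically, uniformly in the point.
  Hence almost surely the filled Julia set has no interior, and for some \<open>m\<close> there are infinitely many
  times \<open>k\<close> such that all critical points born before \<open>k\<close> have escaped by time \<open>k + m\<close>. A normal family
  argument for inverse branches at these times shows that the Julia set is totally disconnected.
  If the orbit of \<open>0\<close> is bounded, every filled Julia set is a nested intersection of connected preimages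
  of a disc, and its complement is connected by the maximum principle, so its boundary is connected.
\<close>

subsection \<open>Non-autonomous iteration\<close>

text \<open>The noise as seen from time \<open>j\<close> on. Thus
  \<open>seq_iter (shiftseq j \<omega>) n 0\<close> follows, for \<open>n\<close> steps, the
  critical point that enters at time \<open>j\<close>.\<close>

definition shiftseq :: "nat \<Rightarrow> (nat \<Rightarrow> 'a) \<Rightarrow> nat \<Rightarrow> 'a" where
  "shiftseq j \<omega> = (\<lambda>i. \<omega> (j + i))"

lemma shiftseq_apply: "shiftseq j \<omega> i = \<omega> (j + i)"
  by (simp add: shiftseq_def)

lemma shiftseq_0 [simp]: "shiftseq 0 \<omega> = \<omega>"
  by (simp add: shiftseq_def)

lemma shiftseq_shiftseq [simp]: "shiftseq i (shiftseq j \<omega>) = shiftseq (j + i) \<omega>"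
  by (simp add: shiftseq_def add.assoc)

lemma shiftseq_Omega: "\<omega> \<in> Omega c r \<Longrightarrow> shiftseq j \<omega> \<in> Omega c r"
  by (simp add: Omega_def shiftseq_def)

lemma seq_iter_add:
  "seq_iter \<omega> (m + n) z = seq_iter (shiftseq m \<omega>) n (seq_iter \<omega> m z)"
  by (induction n) (simp_all add: shiftseq_apply)

lemma seq_iter_Suc_shift:
  "seq_iter \<omega> (Suc n) z = seq_iter (shiftseq 1 \<omega>) n (fq (\<omega> 0) z)"
  using seq_iter_add[of \<omega> 1 n z] by simp

lemma seq_iter_cong:
  "(\<And>i. i < n \<Longrightarrow> \<omega> i = \<omega>' i) \<Longrightarrow> seq_iter \<omega> n z = seq_iter \<omega>' n z"
  by (induction n) simp_all

lemma continuous_on_seq_iter [continuous_intros]: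
  fixes z :: "'a::topological_space \<Rightarrow> complex"
  assumes "\<And>i. continuous_on S (\<lambda>x. \<omega> x i)" "continuous_on S z"
  shows "continuous_on S (\<lambda>x. seq_iter (\<omega> x) n (z x))"
proof (induction n)
  case (Suc n)
  have "continuous_on S (\<lambda>x. (seq_iter (\<omega> x) n (z x))^2 + \<omega> x n)"
    by (intro continuous_on_add continuous_on_power Suc assms)
  then show ?case by (simp add: fq_def)
qed (use assms in simp)

lemma holomorphic_on_seq_iter [holomorphic_intros]:
  assumes "\<And>i. (\<lambda>x. \<omega> x i) holomorphic_on S" "z holomorphic_on S"
  shows "(\<lambda>x. seq_iter (\<omega> x) n (z x)) holomorphic_on S"
proof (induction n)
  case (Suc n)
  have "(\<lambda>x. (seq_iter (\<omega> x) n (z x))^2 + \<omega> x n) holomorphic_on S"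
    by (intro holomorphic_on_add holomorphic_on_power Suc assms)
  then show ?case by (simp add: fq_def)
qed (use assms in simp)

lemma has_field_derivative_seq_iter:
  "(seq_iter \<omega> n has_field_derivative (\<Prod>i<n. 2 * seq_iter \<omega> i z)) (at z)"
proof (induction n)
  case 0
  then show ?case by (simp add: id_def)
next
  case (Suc n)
  have "((\<lambda>x. (seq_iter \<omega> n x)^2 + \<omega> n) has_field_derivative
          (\<Prod>i<Suc n. 2 * seq_iter \<omega> i z)) (at z)"
    using DERIV_add[OF DERIV_power[OF Suc, of 2] DERIV_const[of "\<omega> n"]]
    by (simp add: algebra_simps)
  then show ?case by (simp add: fq_def o_def)
qed

lemma seq_iter_invariant:
  assumes "\<And>c'. c' \<in> cball c r \<Longrightarrow> fq c' ` L \<subseteq> L" "\<omega> \<in> Omega c r" "z \<in> L"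
  shows "seq_iter \<omega> n z \<in> L"
  using assms by (induction n) (auto simp: Omega_def)

lemma seq_iter_Suc_in_Gsg: "\<omega> \<in> Omega c r \<Longrightarrow> seq_iter \<omega> (Suc n) \<in> Gsg c r"
proof (induction n)
  case 0
  then show ?case by (auto simp: Omega_def intro: Gsg.gen)
next
  case (Suc n)
  have "fq (\<omega> (Suc n)) \<circ> seq_iter \<omega> (Suc n) \<in> Gsg c r"
    using Suc by (intro Gsg.comp Gsg.gen) (auto simp: Omega_def simp del: seq_iter.simps)
  then show ?case by (simp only: seq_iter.simps(2)[of _ "Suc n"])
qed

lemma Gsg_imp_seq_iter: "g \<in> Gsg c r \<Longrightarrow> \<exists>\<omega>\<in>Omega c r. \<exists>n. g = seq_iter \<omega> (Suc n)"
proof (induction rule: Gsg.induct)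
  case (gen c')
  then show ?case
    by (intro bexI[of _ "\<lambda>_. c'"] exI[of _ 0]) (auto simp: Omega_def)
next
  case (comp g h)
  then obtain \<omega>1 n1 \<omega>2 n2 where 1: "\<omega>1 \<in> Omega c r" "g = seq_iter \<omega>1 (Suc n1)"
    and 2: "\<omega>2 \<in> Omega c r" "h = seq_iter \<omega>2 (Suc n2)" by blast
  \<comment> \<open>A composition is realised by concatenation: the parameters of \<open>h\<close>
    come first, since \<open>h\<close> is applied first.\<close>
  define \<omega> where "\<omega> = (\<lambda>i. if i < Suc n2 then \<omega>2 i else \<omega>1 (i - Suc n2))"
  have "\<omega> \<in> Omega c r" using 1 2 by (auto simp: \<omega>_def Omega_def)
  moreover have "g \<circ> h = seq_iter \<omega> (Suc (Suc n2 + n1))"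
  proof
    fix z
    have "shiftseq (Suc n2) \<omega> = \<omega>1" by (auto simp: \<omega>_def shiftseq_def)
    moreover have "seq_iter \<omega> (Suc n2) z = seq_iter \<omega>2 (Suc n2) z"
      by (rule seq_iter_cong) (simp add: \<omega>_def)
    ultimately show "(g \<circ> h) z = seq_iter \<omega> (Suc (Suc n2 + n1)) z"
      using seq_iter_add[of \<omega> "Suc n2" "Suc n1" z] 1 2 by simp
  qed
  ultimately show ?case by blast
qed

lemma Gsg_orbit_eq: "(\<Union>g\<in>Gsg c r. {g z}) = {seq_iter \<omega> (Suc n) z | \<omega> n. \<omega> \<in> Omega c r}"
proof safe
  fix g assume "g \<in> Gsg c r"
  from Gsg_imp_seq_iter[OF this] show "\<exists>\<omega> n. g z = seq_iter \<omega> (Suc n) z \<and> \<omega> \<in> Omega c r" by blast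
next
  fix \<omega> n assume "\<omega> \<in> Omega c r"
  from seq_iter_Suc_in_Gsg[OF this] show "seq_iter \<omega> (Suc n) z \<in> (\<Union>g\<in>Gsg c r. {g z})" by blast
qed

lemma Gsg_invariant_iff:
  "(\<forall>g\<in>Gsg c r. g ` L \<subseteq> L) \<longleftrightarrow> (\<forall>c'\<in>cball c r. fq c' ` L \<subseteq> L)"
proof safe
  fix g z assume *: "\<forall>c'\<in>cball c r. fq c' ` L \<subseteq> L" "g \<in> Gsg c r" "z \<in> L"
  from *(2) have "g ` L \<subseteq> L"
    by (induction rule: Gsg.induct) (use *(1) in \<open>auto simp: image_subset_iff\<close>)
  with *(3) show "g z \<in> L" by auto
qed (use Gsg.gen in blast)

subsection \<open>Escape\<close>

text \<open>From \<open>R \<ge> 2\<close> and \<open>cmod z \<ge> R\<close> follows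
  \<open>cmod z ^ 2 \<ge> R * cmod z \<ge> 2 * cmod z + (R - 2)\<close>, and \<open>R - 2\<close>
  absorbs the parameter.\<close>

lemma fq_escape:
  assumes "cmod c' + 2 \<le> R" "R \<le> cmod z"
  shows "2 * cmod z \<le> cmod (fq c' z)"
proof -
  have "R \<ge> 2" using assms(1) norm_ge_zero[of c'] by linarith
  have "R * cmod z \<le> cmod z ^ 2"
    using assms by (simp add: power2_eq_square mult_right_mono)
  moreover have "(R - 2) * 1 \<le> (R - 2) * cmod z"
    using assms \<open>R \<ge> 2\<close> by (intro mult_left_mono) auto
  moreover have "cmod (z^2) - cmod c' \<le> cmod (fq c' z)"
    unfolding fq_def by (rule norm_diff_ineq)
  ultimately show ?thesis using assms(1) by (simp add: norm_power algebra_simps)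
qed

text \<open>One escape radius for all parameters of the sequence. The condition survives shifts and
  mentions neither \<open>c\<close> nor \<open>r\<close>, so the deterministic theory can be
  developed for single sequences.\<close>

definition admissible :: "real \<Rightarrow> (nat \<Rightarrow> complex) \<Rightarrow> bool" where
  "admissible R \<omega> \<longleftrightarrow> (\<forall>n. cmod (\<omega> n) + 2 \<le> R)"

lemma admissible_shiftseq [simp]: "admissible R \<omega> \<Longrightarrow> admissible R (shiftseq j \<omega>)"
  by (simp add: admissible_def shiftseq_def)

lemma admissible_ge_2: "admissible R \<omega> \<Longrightarrow> R \<ge> 2"
  unfolding admissible_def by (drule spec[of _ 0]) (use norm_ge_zero[of "\<omega> 0"] in linarith)

lemma Omega_admissible:
  assumes "\<omega> \<in> Omega c r" shows "admissible (cmod c + r + 2) \<omega>"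
  unfolding admissible_def
proof
  fix n
  have "cmod (\<omega> n - c) \<le> r" using assms by (simp add: Omega_def dist_norm norm_minus_commute)
  then show "cmod (\<omega> n) + 2 \<le> cmod c + r + 2" using norm_triangle_sub[of "\<omega> n" c] by simp
qed

lemma seq_iter_escape:
  assumes \<omega>: "admissible R \<omega>" and "R \<le> cmod z"
  shows "2 ^ n * cmod z \<le> cmod (seq_iter \<omega> n z)"
proof (induction n)
  case (Suc n)
  have "1 * cmod z \<le> 2 ^ n * cmod z" by (intro mult_right_mono) auto
  then have "R \<le> cmod (seq_iter \<omega> n z)" using Suc assms(2) by simp
  from fq_escape[OF _ this, of "\<omega> n"] Suc \<omega> show ?case by (simp add: admissible_def)
qed simp

lemma seq_iter_ge:
  assumes \<omega>: "admissible R \<omega>" and "R \<le> cmod z"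
  shows "cmod z \<le> cmod (seq_iter \<omega> n z)"
proof -
  have "1 * cmod z \<le> 2 ^ n * cmod z" by (intro mult_right_mono) auto
  then show ?thesis using seq_iter_escape[OF assms, of n] by simp
qed

lemma seq_iter_le_mono:
  assumes \<omega>: "admissible R \<omega>" and "cmod (seq_iter \<omega> n z) \<le> R" "m \<le> n"
  shows "cmod (seq_iter \<omega> m z) \<le> R"
proof (rule ccontr)
  assume "\<not> ?thesis"
  moreover from this have "cmod (seq_iter \<omega> m z) \<le> cmod (seq_iter (shiftseq m \<omega>) (n - m) (seq_iter \<omega> m z))"
    using \<omega> by (intro seq_iter_ge[where R=R]) auto
  ultimately show False
    using assms(2,3) seq_iter_add[of \<omega> m "n - m" z] by simp
qed

lemma seq_iter_growth:
  assumes \<omega>: "admissible R \<omega>" and "cmod (seq_iter \<omega> m z) > R"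
  shows "2 ^ n * R \<le> cmod (seq_iter \<omega> (m + n) z)"
proof -
  have "2 ^ n * R \<le> 2 ^ n * cmod (seq_iter \<omega> m z)" using assms(2) by simp
  also have "\<dots> \<le> cmod (seq_iter (shiftseq m \<omega>) n (seq_iter \<omega> m z))"
    using assms by (intro seq_iter_escape[where R=R]) auto
  finally show ?thesis by (simp add: seq_iter_add)
qed

text \<open>The delay \<open>N\<close> depends neither on the point nor on the time \<open>m\<close>
  at which it leaves the disc; this uniformity is what normality near escaping points needs.\<close>

lemma seq_iter_eventually_ge:
  assumes \<omega>: "admissible R \<omega>"
  obtains N where "\<And>m n z. cmod (seq_iter \<omega> m z) > R \<Longrightarrow> n \<ge> m + N \<Longrightarrow> M \<le> cmod (seq_iter \<omega> n z)"
proof -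
  have R: "R \<ge> 2" by (rule admissible_ge_2[OF \<omega>])
  obtain N where N: "M < 2 ^ N" using real_arch_pow[of 2 M] by auto
  show ?thesis
  proof
    fix m n z assume that: "cmod (seq_iter \<omega> m z) > R" "n \<ge> m + N"
    have "(2::real) ^ N \<le> 2 ^ (n - m)" using that by (intro power_increasing) auto
    also have "\<dots> * 1 \<le> 2 ^ (n - m) * R" using R by (intro mult_left_mono) auto
    finally show "M \<le> cmod (seq_iter \<omega> n z)"
      using seq_iter_growth[OF \<omega> that(1), of "n - m"] that N by simp
  qed
qed

lemma seq_iter_tendsto_infinity:
  assumes \<omega>: "admissible R \<omega>" and "cmod (seq_iter \<omega> m z) > R"
  shows "filterlim (\<lambda>n. seq_iter \<omega> n z) at_infinity sequentially"
  unfolding filterlim_at_infinity[OF order_refl] eventually_sequentially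
proof safe
  fix M :: real
  obtain N where "\<And>m n z. cmod (seq_iter \<omega> m z) > R \<Longrightarrow> n \<ge> m + N \<Longrightarrow> M \<le> cmod (seq_iter \<omega> n z)"
    using seq_iter_eventually_ge[OF \<omega>] by blast
  then show "\<exists>N. \<forall>n\<ge>N. M \<le> cmod (seq_iter \<omega> n z)" using assms(2) by blast
qed

text \<open>By the escape dichotomy an orbit that leaves the disc of radius \<open>R\<close> even
  once is unbounded, so an unspecified bound can be replaced by \<open>R\<close>, at time 0 as
  well.\<close>

lemma seq_iter_bounded_iff:
  assumes \<omega>: "admissible R \<omega>"
  shows "bounded (range (\<lambda>n. seq_iter \<omega> (Suc n) z)) \<longleftrightarrow> (\<forall>n. cmod (seq_iter \<omega> n z) \<le> R)"
proof
  assume "bounded (range (\<lambda>n. seq_iter \<omega> (Suc n) z))"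
  then obtain B where B: "\<And>n. cmod (seq_iter \<omega> (Suc n) z) \<le> B"
    unfolding bounded_iff by blast
  show "\<forall>n. cmod (seq_iter \<omega> n z) \<le> R"
  proof (rule ccontr)
    assume "\<not> ?thesis"
    then obtain m where m: "cmod (seq_iter \<omega> m z) > R" by (auto simp: not_le)
    obtain N where "\<And>m n z. cmod (seq_iter \<omega> m z) > R \<Longrightarrow> n \<ge> m + N \<Longrightarrow> B + 1 \<le> cmod (seq_iter \<omega> n z)"
      using seq_iter_eventually_ge[OF \<omega>] by blast
    from this[OF m, of "Suc (m + N)"] B[of "m + N"] show False by simp
  qed
next
  assume "\<forall>n. cmod (seq_iter \<omega> n z) \<le> R"
  then show "bounded (range (\<lambda>n. seq_iter \<omega> (Suc n) z))"
    unfolding bounded_iff by (intro exI[of _ R]) (simp del: seq_iter.simps)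
qed

subsection \<open>Inverse branches\<close>

text \<open>Induction peels off the first map: a branch \<open>h\<close> for the remaining maps is
  pulled back by a square root of \<open>h u - \<omega> 0\<close>. No critical point reaches
  \<open>U\<close>, so this function has no zeros on the simply connected \<open>U\<close>. The
  connected set \<open>C\<close> serves to select one branch that inverts the iterate at all points
  of \<open>C\<close> simultaneously.\<close>

lemma inverse_branch:
  assumes U: "open U" "simply_connected U"
  shows "connected C \<Longrightarrow> C \<noteq> {} \<Longrightarrow> \<forall>y\<in>C. seq_iter \<omega> k y \<in> U \<Longrightarrow>
    \<forall>j<k. seq_iter (shiftseq j \<omega>) (k - j) 0 \<notin> U \<Longrightarrow>
    \<exists>g. g holomorphic_on U \<and> (\<forall>u\<in>U. seq_iter \<omega> k (g u) = u) \<and> (\<forall>y\<in>C. g (seq_iter \<omega> k y) = y)"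
proof (induction k arbitrary: \<omega> C)
  case 0
  then show ?case by (intro exI[of _ "\<lambda>u. u"]) auto
next
  case (Suc k)
  let ?\<omega>' = "shiftseq 1 \<omega>"
  let ?F = "seq_iter \<omega> (Suc k)"
  have F: "?F y = seq_iter ?\<omega>' k (fq (\<omega> 0) y)" for y by (rule seq_iter_Suc_shift)
  have "\<exists>h. h holomorphic_on U \<and> (\<forall>u\<in>U. seq_iter ?\<omega>' k (h u) = u) \<and>
      (\<forall>y\<in>fq (\<omega> 0) ` C. h (seq_iter ?\<omega>' k y) = y)"
  proof (rule Suc.IH)
    show "connected (fq (\<omega> 0) ` C)"
      unfolding fq_def by (intro connected_continuous_image continuous_intros Suc.prems)
    show "\<forall>y\<in>fq (\<omega> 0) ` C. seq_iter ?\<omega>' k y \<in> U"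
      using Suc.prems(3) F by auto
    show "\<forall>j<k. seq_iter (shiftseq j ?\<omega>') (k - j) 0 \<notin> U"
    proof safe
      fix j assume "j < k" "seq_iter (shiftseq j ?\<omega>') (k - j) 0 \<in> U"
      then show False using Suc.prems(4)[rule_format, of "Suc j"] by simp
    qed
  qed (use Suc.prems in auto)
  then obtain h where h: "h holomorphic_on U" "\<And>u. u \<in> U \<Longrightarrow> seq_iter ?\<omega>' k (h u) = u"
    and hC: "\<And>y. y \<in> C \<Longrightarrow> h (?F y) = fq (\<omega> 0) y"
    unfolding F by blast
  \<comment> \<open>A zero would mean that \<open>h u\<close> is the critical value of the first
    map, so that \<open>?F 0 = u\<close> lies in \<open>U\<close>, against the hypothesis for
    \<open>j = 0\<close>.\<close>
  have nz: "h u - \<omega> 0 \<noteq> 0" if "u \<in> U" for u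
    using Suc.prems(4)[rule_format, of 0] h(2)[OF that] that F[of 0] by (auto simp: fq_def)
  obtain s where s: "s holomorphic_on U" "\<And>u. u \<in> U \<Longrightarrow> h u - \<omega> 0 = s u ^ 2"
  proof (rule simply_connected_imp_holomorphic_sqrt[of "\<lambda>u. h u - \<omega> 0" U])
    show "(\<lambda>u. h u - \<omega> 0) holomorphic_on U" by (intro holomorphic_intros h)
    show "locally path_connected U" by (rule open_imp_locally_path_connected[OF U(1)])
  qed (use nz U in auto)
  have sq: "s (?F y) ^ 2 = y ^ 2" "y \<noteq> 0" if "y \<in> C" for y
  proof -
    have "?F y \<in> U" using Suc.prems(3) that by blast
    with s(2)[OF this] nz[OF this] hC[OF that] show "s (?F y) ^ 2 = y ^ 2" "y \<noteq> 0"
      by (auto simp: fq_def)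
  qed
  \<comment> \<open>The quotient of two square roots of \<open>y ^ 2\<close> is a continuous sign on
    \<open>C\<close>, hence constant by connectedness. Multiplying \<open>s\<close> by this sign
    yields the branch that is right on all of \<open>C\<close>.\<close>
  let ?\<phi> = "\<lambda>y. s (?F y) / y"
  have "?\<phi> y \<in> {1, -1}" if "y \<in> C" for y
  proof -
    have "?\<phi> y ^ 2 = 1" using sq[OF that] by (simp add: power_divide del: seq_iter.simps)
    then show ?thesis by (simp only: power2_eq_1_iff) blast
  qed
  then have sub: "?\<phi> ` C \<subseteq> {1, -1}" by blast
  have "continuous_on C (\<lambda>y. s (?F y))"
  proof (rule continuous_on_compose2[OF holomorphic_on_imp_continuous_on[OF s(1)]])
    show "continuous_on C ?F" by (intro continuous_intros)
    show "?F ` C \<subseteq> U" using Suc.prems(3) by blast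
  qed
  then have "connected (?\<phi> ` C)"
    by (intro connected_continuous_image continuous_on_divide continuous_on_id Suc.prems)
       (use sq(2) in auto)
  then have "\<exists>a. ?\<phi> ` C = {a}"
    using connected_finite_iff_sing[of "?\<phi> ` C"] finite_subset[OF sub] Suc.prems(2) by auto
  then obtain a where a: "?\<phi> ` C = {a}" ..
  with sub have a1: "a = 1 \<or> a = -1" by auto
  show ?case
  proof (intro exI[of _ "\<lambda>u. a * s u"] conjI ballI)
    show "(\<lambda>u. a * s u) holomorphic_on U" by (intro holomorphic_intros s)
  next
    fix u assume "u \<in> U"
    have "fq (\<omega> 0) (a * s u) = h u"
      using s(2)[OF \<open>u \<in> U\<close>] a1 by (auto simp: fq_def power_mult_distrib algebra_simps)
    then show "?F (a * s u) = u" using h(2)[OF \<open>u \<in> U\<close>] by (simp only: F)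
  next
    fix y assume "y \<in> C"
    then have "?\<phi> y = a" using a by blast
    then have "s (?F y) = a * y" using sq(2)[OF \<open>y \<in> C\<close>] by (simp add: divide_eq_eq del: seq_iter.simps)
    then show "a * s (?F y) = y" using a1 by (auto simp del: seq_iter.simps)
  qed
qed

subsection \<open>Invariant compact sets contain the critical point\<close>

lemma deriv_eq_prod_inverse_branch:
  assumes "open U" "u \<in> U" "g holomorphic_on U" "\<And>v. v \<in> U \<Longrightarrow> seq_iter \<omega> n (g v) = v"
  shows "(\<Prod>i<n. 2 * seq_iter \<omega> i (g u)) * deriv g u = 1"
proof -
  have "(g has_field_derivative deriv g u) (at u)"
    using assms holomorphic_derivI by blast
  from DERIV_chain[OF has_field_derivative_seq_iter this]
  have "(seq_iter \<omega> n \<circ> g has_field_derivative (\<Prod>i<n. 2 * seq_iter \<omega> i (g u)) * deriv g u) (at u)" .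
  moreover have "(seq_iter \<omega> n \<circ> g has_field_derivative 1) (at u)"
    by (rule has_field_derivative_transform_within_open[OF DERIV_ident assms(1,2)])
       (simp add: assms(4))
  ultimately show ?thesis by (rule DERIV_unique)
qed

text \<open>The disc of radius \<open>d\<close> about the endpoint is free of critical orbits, so an
  inverse branch through \<open>x\<close> lives on it. Its values are bounded, and Cauchy's estimate
  bounds its derivative, the reciprocal of the product, from above.\<close>

lemma expansion_away_from_postcritical:
  assumes \<omega>: "admissible R \<omega>" and "d > 0" "cmod (seq_iter \<omega> n x) \<le> M"
    and crit: "\<And>j. j < n \<Longrightarrow> d \<le> dist (seq_iter \<omega> n x) (seq_iter (shiftseq j \<omega>) (n - j) 0)"
  shows "d / (2 * (R + M + d)) \<le> cmod (\<Prod>i<n. 2 * seq_iter \<omega> i x)"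
proof -
  let ?u = "seq_iter \<omega> n x"
  have R: "R \<ge> 2" using \<omega> by (rule admissible_ge_2)
  have M: "M \<ge> 0" using assms(3) norm_ge_zero order_trans by blast
  obtain g where g: "g holomorphic_on ball ?u d" "\<And>u. u \<in> ball ?u d \<Longrightarrow> seq_iter \<omega> n (g u) = u" "g ?u = x"
  proof -
    have "\<forall>j<n. seq_iter (shiftseq j \<omega>) (n - j) 0 \<notin> ball ?u d"
      using crit by (auto simp: not_less)
    then show ?thesis
      using that inverse_branch[of "ball ?u d" "{x}" \<omega> n] \<open>d > 0\<close>
      by (auto simp: convex_imp_simply_connected)
  qed
  \<comment> \<open>A preimage outside the disc of radius \<open>R\<close> is no larger than its
    image \<open>u\<close>, and \<open>cmod u \<le> M + d\<close>.\<close>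
  have le: "cmod (g u) \<le> R + M + d" if "u \<in> ball ?u d" for u
  proof (cases "R \<le> cmod (g u)")
    case True
    have "cmod u \<le> cmod ?u + dist ?u u" by (metis dist_norm norm_triangle_sub norm_minus_commute)
    then show ?thesis
      using seq_iter_ge[OF \<omega> True, of n] g(2)[OF that] that assms(3) R by auto
  qed (use M R \<open>d > 0\<close> in auto)
  \<comment> \<open>The radius \<open>d/2\<close> keeps the closed disc inside the domain of
    \<open>g\<close>; it is the source of the factor 2 in the bound.\<close>
  have "cmod ((deriv ^^ 1) g ?u) \<le> fact 1 * (R + M + d) / (d/2) ^ 1"
  proof (rule Cauchy_inequality)
    have sub: "cball ?u (d/2) \<subseteq> ball ?u d" using \<open>d > 0\<close> by (auto simp: subset_iff)
    show "continuous_on (cball ?u (d/2)) g"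
      using sub g(1) holomorphic_on_imp_continuous_on continuous_on_subset by blast
    show "g holomorphic_on ball ?u (d/2)"
      by (rule holomorphic_on_subset[OF g(1)]) (use \<open>d > 0\<close> in auto)
    show "cmod (g v) \<le> R + M + d" if "cmod (?u - v) = d/2" for v
      using that \<open>d > 0\<close> by (intro le) (auto simp: dist_norm)
  qed (use \<open>d > 0\<close> in auto)
  then have *: "cmod (deriv g ?u) \<le> 2 * (R + M + d) / d" by (simp add: mult.commute)
  have "(\<Prod>i<n. 2 * seq_iter \<omega> i x) * deriv g ?u = 1"
    using deriv_eq_prod_inverse_branch[of "ball ?u d" ?u g \<omega> n] g \<open>d > 0\<close> by simp
  then have 1: "cmod (\<Prod>i<n. 2 * seq_iter \<omega> i x) * cmod (deriv g ?u) = 1"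
    by (metis norm_mult norm_one)
  have "1 \<le> cmod (\<Prod>i<n. 2 * seq_iter \<omega> i x) * (2 * (R + M + d) / d)"
    unfolding 1[symmetric] by (intro mult_left_mono *) auto
  moreover have "R + M + d > 0" using R M \<open>d > 0\<close> by simp
  ultimately show ?thesis using \<open>d > 0\<close> by (simp add: field_simps)
qed

text \<open>Moving all parameters simultaneously, with phases chosen so that the first-order effects add up,
  keeps the orbit in \<open>L\<close>; the Cauchy estimate in the perturbation parameter then bounds the sum of
  the derivatives along the orbit.\<close>

lemma sum_derivatives_bounded:
  assumes inv: "\<And>c'. c' \<in> cball ct \<eta> \<Longrightarrow> fq c' ` L \<subseteq> L" and "\<eta> > 0" "x \<in> L"
    and M: "\<And>z. z \<in> L \<Longrightarrow> cmod z \<le> M"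
  shows "\<eta> * (\<Sum>j<n. \<Prod>i\<in>{Suc j..<n}. cmod (2 * seq_iter (\<lambda>_. ct) i x)) \<le> M"
proof -
  define xs where "xs i = seq_iter (\<lambda>_. ct) i x" for i
  \<comment> \<open>The phase of \<open>w\<close>, with default 1 at \<open>w = 0\<close> so that it
    always has modulus 1.\<close>
  define dir where "dir w = (if w = 0 then 1 else sgn w)" for w :: complex
  have dir: "cmod (dir w) = 1" "cmod (w + of_real \<eta> * dir w) = cmod w + \<eta>" for w
  proof -
    show "cmod (dir w) = 1" by (simp add: dir_def norm_sgn)
    have "w + of_real \<eta> * dir w = of_real (cmod w + \<eta>) * dir w"
      by (simp add: dir_def sgn_div_norm scaleR_conv_of_real field_simps)
    then show "cmod (w + of_real \<eta> * dir w) = cmod w + \<eta>"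
      using \<open>cmod (dir w) = 1\<close> \<open>\<eta> > 0\<close> by (simp only: norm_mult norm_of_real) simp
  qed
  \<comment> \<open>\<open>D n\<close> is the derivative at \<open>t = 0\<close> of the orbit with
    parameters \<open>ct + t * a i\<close>. The phase of \<open>a i\<close> is aligned with the
    error carried over from earlier steps, so moduli add and nothing cancels.\<close>
  define D where "D = rec_nat 0 (\<lambda>i d. 2 * xs i * d + of_real \<eta> * dir (2 * xs i * d))"
  define a where "a i = of_real \<eta> * dir (2 * xs i * D i)" for i
  have D0: "D 0 = 0" and DS: "D (Suc i) = 2 * xs i * D i + a i" for i
    by (simp_all add: D_def a_def)
  have a: "cmod (a i) = \<eta>" for i using \<open>\<eta> > 0\<close> by (simp add: a_def norm_mult dir)
  have normD: "cmod (D n) = \<eta> * (\<Sum>j<n. \<Prod>i\<in>{Suc j..<n}. cmod (2 * xs i))" for n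
  proof (induction n)
    case (Suc n)
    have "cmod (D (Suc n)) = cmod (2 * xs n * D n) + \<eta>" by (simp only: DS a_def dir)
    also have "cmod (2 * xs n * D n) = cmod (2 * xs n) * (\<eta> * (\<Sum>j<n. \<Prod>i\<in>{Suc j..<n}. cmod (2 * xs i)))"
      using Suc by (simp only: norm_mult)
    also have "\<dots> = \<eta> * (\<Sum>j<n. \<Prod>i\<in>{Suc j..<Suc n}. cmod (2 * xs i))"
      by (simp add: sum_distrib_left sum_distrib_right mult_ac)
    finally show ?case by (simp add: algebra_simps)
  qed (simp add: D0)
  define F where "F t = seq_iter (\<lambda>i. ct + t * a i) n x" for t
  have "((\<lambda>t. seq_iter (\<lambda>i. ct + t * a i) n x) has_field_derivative D n) (at 0)" for n
  proof (induction n)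
    case (Suc n)
    have "((\<lambda>t. (seq_iter (\<lambda>i. ct + t * a i) n x)^2 + (ct + t * a n))
        has_field_derivative D (Suc n)) (at 0)"
      by (rule derivative_eq_intros Suc refl)+ (simp add: DS xs_def)
    then show ?case by (simp add: fq_def)
  qed (simp add: D0)
  then have "deriv F 0 = D n" unfolding F_def by (rule DERIV_imp_deriv)
  \<comment> \<open>On the unit circle all perturbed parameters have distance \<open>\<eta>\<close>
    from \<open>ct\<close>, so \<open>F t\<close> stays in \<open>L\<close>; the resulting bound
    \<open>M\<close> is independent of \<open>n\<close>.\<close>
  have "cmod ((deriv ^^ 1) F 0) \<le> fact 1 * M / 1 ^ 1"
  proof (rule Cauchy_inequality)
    show "F holomorphic_on ball 0 1" "continuous_on (cball 0 1) F"
      unfolding F_def by (intro holomorphic_intros continuous_intros)+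
    fix t :: complex assume t: "cmod (0 - t) = 1"
    have "(\<lambda>i. ct + t * a i) \<in> Omega ct \<eta>" using a t by (simp add: Omega_def dist_norm norm_mult)
    then show "cmod (F t) \<le> M"
      unfolding F_def by (intro M seq_iter_invariant[OF inv]) (use \<open>x \<in> L\<close> in auto)
  qed simp
  then show ?thesis using \<open>deriv F 0 = D n\<close> normD[of n] by (simp add: xs_def)
qed

lemma invariant_compact_contains_zero:
  assumes "superattracting ct" "ct \<in> ball c r" "compact L" "L \<noteq> {}"
    and inv: "\<And>c'. c' \<in> cball c r \<Longrightarrow> fq c' ` L \<subseteq> L"
  shows "0 \<in> L"
proof (rule ccontr)
  assume "0 \<notin> L"
  let ?\<omega> = "\<lambda>_::nat. ct"
  let ?f = "seq_iter ?\<omega>"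
  have sh [simp]: "shiftseq j ?\<omega> = ?\<omega>" for j by (simp add: shiftseq_def)
  have add: "?f (m + n) z = ?f n (?f m z)" for m n z using seq_iter_add[of ?\<omega> m n z] by simp
  have "?f n z = (fq ct ^^ n) z" for n z by (induction n) simp_all
  then obtain p where p: "p \<ge> 1" "?f p 0 = 0" using assms(1) unfolding superattracting_def by metis
  have per: "?f (p * k + n) 0 = ?f n 0" for k n
  proof (induction k)
    case (Suc k)
    have "?f (p * Suc k + n) 0 = ?f (p * k + n) (?f p 0)" by (simp add: add[symmetric] algebra_simps)
    then show ?case using Suc p by simp
  qed simp
  \<comment> \<open>By periodicity this finite set contains the whole forward orbit of 0 under
    \<open>fq ct\<close>.\<close>
  define P where "P = (\<lambda>n. ?f n 0) ` {..<p}"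
  have P: "?f n 0 \<in> P" for n
    using per[of "n div p" "n mod p"] p unfolding P_def by (intro image_eqI[of _ _ "n mod p"]) auto
  have \<omega>: "?\<omega> \<in> Omega c r" using assms(2) by (simp add: Omega_def)
  \<comment> \<open>A point of the cycle returns to 0 after finitely many steps, so invariance would
    put 0 into \<open>L\<close>.\<close>
  have "L \<inter> P = {}"
  proof safe
    fix y assume y: "y \<in> L" "y \<in> P"
    then obtain n where n: "n < p" "y = ?f n 0" by (auto simp: P_def)
    have "?f (p - n) y = ?f p 0" using n by (simp add: add[symmetric])
    then show "y \<in> {}" using seq_iter_invariant[OF inv \<omega> y(1), of "p - n"] p \<open>0 \<notin> L\<close> by simp
  qed
  moreover have "closed P" by (simp add: P_def finite_imp_closed)
  ultimately obtain d where d: "d > 0" "\<And>x y. x \<in> L \<Longrightarrow> y \<in> P \<Longrightarrow> d \<le> dist x y"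
    using separate_compact_closed[OF \<open>compact L\<close>, of P] by blast
  obtain M where M: "\<And>z. z \<in> L \<Longrightarrow> cmod z \<le> M"
    using compact_imp_bounded[OF \<open>compact L\<close>] unfolding bounded_iff by blast
  obtain x where x: "x \<in> L" using \<open>L \<noteq> {}\<close> by blast
  have xL: "?f n x \<in> L" for n using seq_iter_invariant[OF inv \<omega> x] .
  define R where "R = cmod c + r + 2"
  have adm: "admissible R ?\<omega>" unfolding R_def by (rule Omega_admissible[OF \<omega>])
  define \<kappa> where "\<kappa> = d / (2 * (R + M + d))"
  have "M \<ge> 0" using M[OF x] norm_ge_zero order_trans by blast
  then have "\<kappa> > 0" using d admissible_ge_2[OF adm] by (simp add: \<kappa>_def)
  \<comment> \<open>The expansion bound is applied to the orbit segment that starts at time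
    \<open>Suc j\<close>. It ends in \<open>L\<close>, at distance at least \<open>d\<close> from
    \<open>P\<close>, so \<open>\<kappa>\<close> depends neither on \<open>j\<close> nor on
    \<open>n\<close>.\<close>
  have low: "\<kappa> \<le> (\<Prod>i\<in>{Suc j..<n}. cmod (2 * ?f i x))" if "j < n" for j n
  proof -
    have "\<kappa> \<le> cmod (\<Prod>i<n - Suc j. 2 * ?f i (?f (Suc j) x))"
      unfolding \<kappa>_def
    proof (rule expansion_away_from_postcritical[OF adm d(1)])
      have e: "?f (n - Suc j) (?f (Suc j) x) = ?f n x" using that by (simp only: add[symmetric]) simp
      show "cmod (?f (n - Suc j) (?f (Suc j) x)) \<le> M" unfolding e by (intro M xL)
      fix i
      show "d \<le> dist (?f (n - Suc j) (?f (Suc j) x)) (seq_iter (shiftseq i ?\<omega>) (n - Suc j - i) 0)"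
        unfolding e sh by (intro d xL P)
    qed
    also have "\<dots> = (\<Prod>i<n - Suc j. cmod (2 * ?f (i + Suc j) x))"
      by (simp only: add[symmetric] prod_norm add.commute)
    also have "\<dots> = (\<Prod>i\<in>{0 + Suc j..<(n - Suc j) + Suc j}. cmod (2 * ?f i x))"
      by (simp only: prod.shift_bounds_nat_ivl lessThan_atLeast0)
    finally show ?thesis using that by simp
  qed
  define \<eta> where "\<eta> = r - dist c ct"
  have "\<eta> > 0" using assms(2) by (simp add: \<eta>_def)
  have "cball ct \<eta> \<subseteq> cball c r"
  proof
    fix z assume "z \<in> cball ct \<eta>"
    then show "z \<in> cball c r" using dist_triangle[of c z ct] by (simp add: \<eta>_def)
  qed
  then have inv': "fq c' ` L \<subseteq> L" if "c' \<in> cball ct \<eta>" for c' using inv that by blast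
  \<comment> \<open>Each of the \<open>n\<close> summands is at least \<open>\<kappa>\<close>, while
    their weighted sum never exceeds \<open>M\<close>; large \<open>n\<close> gives the
    contradiction.\<close>
  have "\<eta> * (real n * \<kappa>) \<le> M" for n
  proof -
    have "real n * \<kappa> = (\<Sum>j<n. \<kappa>)" by simp
    also have "\<dots> \<le> (\<Sum>j<n. \<Prod>i\<in>{Suc j..<n}. cmod (2 * ?f i x))"
      by (intro sum_mono low) auto
    finally have "\<eta> * (real n * \<kappa>) \<le> \<eta> * \<dots>" using \<open>\<eta> > 0\<close> by simp
    also have "\<dots> \<le> M" by (rule sum_derivatives_bounded[OF inv' \<open>\<eta> > 0\<close> x M])
    finally show ?thesis .
  qed
  moreover obtain n where "real n * (\<eta> * \<kappa>) > M"
    using reals_Archimedean3[of "\<eta> * \<kappa>"] \<open>\<eta> > 0\<close> \<open>\<kappa> > 0\<close> by auto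
  ultimately show False by (metis mult.left_commute not_less)
qed

subsection \<open>The filled Julia set\<close>

text \<open>For admissible \<open>\<omega>\<close> this is the set of points with bounded orbit; the
  fixed bound makes it an intersection of nested compact sets.\<close>

definition filled :: "real \<Rightarrow> (nat \<Rightarrow> complex) \<Rightarrow> complex set" where
  "filled R \<omega> = {z. \<forall>n. cmod (seq_iter \<omega> n z) \<le> R}"

lemma filled_eq_INT: "filled R \<omega> = (\<Inter>n. {z. cmod (seq_iter \<omega> n z) \<le> R})"
  by (auto simp: filled_def)

lemma compact_seq_iter_le:
  assumes "admissible R \<omega>"
  shows "compact {z. cmod (seq_iter \<omega> n z) \<le> R}"
proof (rule compact_eq_bounded_closed[THEN iffD2], intro conjI)
  have "{z. cmod (seq_iter \<omega> n z) \<le> R} \<subseteq> cball 0 R"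
    using seq_iter_le_mono[OF assms, of n _ 0] by auto
  then show "bounded {z. cmod (seq_iter \<omega> n z) \<le> R}"
    using bounded_subset bounded_cball by blast
  show "closed {z. cmod (seq_iter \<omega> n z) \<le> R}"
    by (intro closed_Collect_le continuous_intros)
qed

lemma compact_filled: "admissible R \<omega> \<Longrightarrow> compact (filled R \<omega>)"
  unfolding filled_eq_INT by (intro compact_Inter) (auto intro: compact_seq_iter_le)

lemma surj_fq: "surj (fq c)"
  by (rule surjI[of _ "\<lambda>w. csqrt (w - c)"]) (simp add: fq_def)

lemma surj_seq_iter: "surj (seq_iter \<omega> n)"
proof (induction n)
  case (Suc n)
  then show ?case unfolding seq_iter.simps by (rule comp_surj[OF _ surj_fq])
qed simp

text \<open>Each set in the nested intersection contains a preimage of 0, as the iterates are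
  surjective.\<close>

lemma filled_nonempty:
  assumes "admissible R \<omega>"
  shows "filled R \<omega> \<noteq> {}"
  unfolding filled_eq_INT
proof (rule compact_nest)
  fix n
  obtain z where "seq_iter \<omega> n z = 0" using surj_seq_iter[of \<omega> n] by (metis surjD)
  then have "cmod (seq_iter \<omega> n z) \<le> R" using admissible_ge_2[OF assms] by simp
  then show "{z. cmod (seq_iter \<omega> n z) \<le> R} \<noteq> {}" by blast
qed (use assms compact_seq_iter_le seq_iter_le_mono in blast)+

lemma filled_uminus: "z \<in> filled R \<omega> \<Longrightarrow> - z \<in> filled R \<omega>"
proof -
  have *: "seq_iter \<omega> (Suc n) (-z) = seq_iter \<omega> (Suc n) z" for n
    by (simp only: seq_iter_Suc_shift fq_def power2_minus)
  have "cmod (seq_iter \<omega> n (-z)) = cmod (seq_iter \<omega> n z)" for n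
    by (cases n) (simp_all only: *, simp)
  then show "z \<in> filled R \<omega> \<Longrightarrow> - z \<in> filled R \<omega>" by (simp add: filled_def)
qed

lemma filled_shift:
  assumes "admissible R \<omega>" "fq (\<omega> 0) z \<in> filled R (shiftseq 1 \<omega>)"
  shows "z \<in> filled R \<omega>"
proof -
  have *: "cmod (seq_iter \<omega> (Suc n) z) \<le> R" for n
    using assms(2) by (simp only: seq_iter_Suc_shift filled_def) blast
  have "cmod (seq_iter \<omega> n z) \<le> R" for n
    using seq_iter_le_mono[OF assms(1) *[of n], of n] by simp
  then show ?thesis by (simp add: filled_def)
qed

text \<open>Since the first map is even, the filled set is symmetric, and a single point would have
  to be 0. The filled set of the shifted sequence is then contained in \<open>{\<omega> 0}\<close>,
  so \<open>\<omega> 0 = 0\<close> for the same reason. Repeating this makes all parameters vanish,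
  but then 1 has a bounded orbit.\<close>

lemma filled_two_points:
  assumes "admissible R \<omega>"
  shows "\<not> filled R \<omega> \<subseteq> {a}"
proof
  assume sub: "filled R \<omega> \<subseteq> {a}"
  have sym0: "b = 0" if sb: "filled R \<omega>' \<subseteq> {b}" and ad: "admissible R \<omega>'" for \<omega>' b
  proof -
    obtain w where w: "w \<in> filled R \<omega>'" using filled_nonempty[OF ad] by (meson ex_in_conv)
    have "w = b" using subsetD[OF sb w] by simp
    moreover have "- w = b" using subsetD[OF sb filled_uminus[OF w]] by simp
    ultimately have "b = - b" by simp
    then have "2 * b = 0" by (metis mult_2 right_minus)
    then show ?thesis by simp
  qed
  have a0: "a = 0" using sym0 sub assms by blast
  have step: "\<omega>' 0 = 0 \<and> filled R (shiftseq 1 \<omega>') \<subseteq> {0}"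
    if "filled R \<omega>' \<subseteq> {0}" "admissible R \<omega>'" for \<omega>'
  proof -
    have "w = \<omega>' 0" if w: "w \<in> filled R (shiftseq 1 \<omega>')" for w
    proof -
      obtain z where "fq (\<omega>' 0) z = w" using surj_fq[of "\<omega>' 0"] by (metis surjD)
      with w filled_shift[OF \<open>admissible R \<omega>'\<close>, of z] \<open>filled R \<omega>' \<subseteq> {0}\<close> show ?thesis
        by (auto simp: fq_def)
    qed
    then have "filled R (shiftseq 1 \<omega>') \<subseteq> {\<omega>' 0}" by blast
    with sym0[OF this] that show ?thesis by simp
  qed
  have sh: "filled R (shiftseq n \<omega>) \<subseteq> {0}" for n
  proof (induction n)
    case 0 then show ?case using sub a0 by simp
  next
    case (Suc n)
    then show ?case using step[of "shiftseq n \<omega>"] assms by simp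
  qed
  have "\<omega> n = 0" for n using step[OF sh[of n]] assms by (simp add: shiftseq_apply)
  then have "seq_iter \<omega> n 1 = 1" for n by (induction n) (simp_all add: fq_def)
  then have "1 \<in> filled R \<omega>" using admissible_ge_2[OF assms] by (simp add: filled_def)
  then show False using sub a0 by auto
qed

text \<open>This makes connectedness and total disconnectedness of the Julia set incompatible. If
  there is an interior point, horizontal rays to its right and left meet the boundary at different
  points.\<close>

lemma frontier_filled_two_points:
  assumes "admissible R \<omega>"
  shows "\<exists>x\<in>frontier (filled R \<omega>). \<exists>y\<in>frontier (filled R \<omega>). x \<noteq> y"
proof (cases "interior (filled R \<omega>) = {}")
  case True
  then have "frontier (filled R \<omega>) = filled R \<omega>"
    using compact_imp_closed[OF compact_filled[OF assms]] by (simp add: frontier_def)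
  then show ?thesis using filled_nonempty[OF assms] filled_two_points[OF assms] by blast
next
  case False
  then obtain a where a: "a \<in> interior (filled R \<omega>)" by blast
  have b: "bounded (filled R \<omega>)" using compact_filled[OF assms] compact_imp_bounded by blast
  obtain d where d: "0 < d" "a + d *\<^sub>R 1 \<in> frontier (filled R \<omega>)"
    using ray_to_frontier[OF b a, of 1] by auto
  obtain e where e: "0 < e" "a + e *\<^sub>R (-1) \<in> frontier (filled R \<omega>)"
    using ray_to_frontier[OF b a, of "-1"] by auto
  have "Re (a + d *\<^sub>R 1) \<noteq> Re (a + e *\<^sub>R (-1))" using d e by simp
  then show ?thesis using d e by metis
qed

section \<open>The Julia set as the boundary of the filled Julia set\<close>

lemma not_filled_nhd:
  assumes "z \<notin> filled R \<omega>"
  shows "\<exists>U m. open U \<and> z \<in> U \<and> (\<forall>y\<in>U. R < cmod (seq_iter \<omega> m y))"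
proof -
  obtain m where m: "R < cmod (seq_iter \<omega> m z)" using assms by (auto simp: filled_def not_le)
  have "open {y. R < cmod (seq_iter \<omega> m y)}"
    by (intro open_Collect_less continuous_intros)
  with m show ?thesis
    by (intro exI[of _ "{y. R < cmod (seq_iter \<omega> m y)}"] exI[of _ m]) simp
qed

text \<open>Normality concerns arbitrary sequences from the family, in which iterates may repeat or
  occur out of order. This reduces them to a constant sequence or to indices tending to
  infinity.\<close>

lemma nat_seq_constant_or_increasing_subseq:
  fixes f :: "nat \<Rightarrow> nat"
  shows "\<exists>\<sigma>. strict_mono \<sigma> \<and> ((\<exists>k. \<forall>n. f (\<sigma> n) = k) \<or> filterlim (\<lambda>n. f (\<sigma> n)) at_top sequentially)"
proof (cases "\<exists>k. infinite (f -` {k})")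
  case True
  then obtain k where k: "infinite (f -` {k})" ..
  have "strict_mono (enumerate (f -` {k}))" using k by (rule strict_mono_enumerate)
  moreover have "f (enumerate (f -` {k}) n) = k" for n using enumerate_in_set[OF k, of n] by simp
  ultimately show ?thesis by blast
next
  case False
  have "eventually (\<lambda>n. N \<le> f n) sequentially" for N
  proof -
    have "f -` {..<N} = (\<Union>k<N. f -` {k})" by auto
    also have "finite \<dots>" using False by blast
    finally have "eventually (\<lambda>n. n \<notin> f -` {..<N}) cofinite"
      by (simp only: eventually_cofinite not_not Collect_mem_eq)
    then show ?thesis by (simp add: cofinite_eq_sequentially not_less)
  qed
  then have "filterlim f at_top sequentially" by (simp add: filterlim_at_top)
  then show ?thesis by (intro exI[of _ id]) (auto simp: strict_mono_def)
qed

text \<open>A whole neighbourhood leaves the disc at one common time, so its iterates tend to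
  infinity uniformly; a subsequence that repeats one iterate converges trivially.\<close>

lemma julia_subset_filled:
  assumes \<omega>: "admissible R \<omega>" and "z \<notin> filled R \<omega>"
  shows "z \<notin> julia \<omega>"
proof -
  let ?F = "\<lambda>n. seq_iter \<omega> (Suc n)"
  obtain U m where U: "open U" "z \<in> U" "\<forall>y\<in>U. R < cmod (seq_iter \<omega> m y)"
    using not_filled_nhd[OF assms(2)] by (elim exE conjE)
  have "normal_family (range ?F) U"
    unfolding normal_family_def
  proof (intro allI impI)
    fix g :: "nat \<Rightarrow> complex \<Rightarrow> complex" assume "\<forall>n. g n \<in> range ?F"
    then have "\<forall>n. \<exists>k. g n = ?F k" by (simp only: image_iff) blast
    then obtain f where f: "g n = ?F (f n)" for n by metis
    obtain \<sigma> where \<sigma>: "strict_mono \<sigma>"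
      "(\<exists>k. \<forall>n. f (\<sigma> n) = k) \<or> filterlim (\<lambda>n. f (\<sigma> n)) at_top sequentially"
      using nat_seq_constant_or_increasing_subseq by blast
    show "\<exists>\<sigma>. strict_mono \<sigma> \<and>
        ((\<exists>h. \<forall>K. compact K \<and> K \<subseteq> U \<longrightarrow> uniform_limit K (\<lambda>n. g (\<sigma> n)) h sequentially) \<or>
         (\<forall>K. compact K \<and> K \<subseteq> U \<longrightarrow> (\<forall>M. \<forall>\<^sub>F n in sequentially. \<forall>z\<in>K. M \<le> cmod (g (\<sigma> n) z))))"
    proof (intro exI[of _ \<sigma>] conjI \<sigma>(1))
      show "(\<exists>h. \<forall>K. compact K \<and> K \<subseteq> U \<longrightarrow> uniform_limit K (\<lambda>n. g (\<sigma> n)) h sequentially) \<or>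
         (\<forall>K. compact K \<and> K \<subseteq> U \<longrightarrow> (\<forall>M. \<forall>\<^sub>F n in sequentially. \<forall>z\<in>K. M \<le> cmod (g (\<sigma> n) z)))"
        using \<sigma>(2)
      proof
        assume "\<exists>k. \<forall>n. f (\<sigma> n) = k"
        then obtain k where "\<And>n. f (\<sigma> n) = k" by blast
        then have "g (\<sigma> n) = ?F k" for n by (simp only: f)
        then have "uniform_limit K (\<lambda>n. g (\<sigma> n)) (?F k) sequentially" for K
          by (simp add: uniform_limit_const del: seq_iter.simps)
        then show ?thesis by blast
      next
        assume lim: "filterlim (\<lambda>n. f (\<sigma> n)) at_top sequentially"
        show ?thesis
        proof (intro disjI2 allI impI)
          fix K M assume K: "compact K \<and> K \<subseteq> U"
          obtain N where N: "\<And>m n z. cmod (seq_iter \<omega> m z) > R \<Longrightarrow> n \<ge> m + N \<Longrightarrow> M \<le> cmod (seq_iter \<omega> n z)"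
            using seq_iter_eventually_ge[OF \<omega>] by blast
          have "\<forall>\<^sub>F n in sequentially. m + N \<le> f (\<sigma> n)"
            using lim by (simp add: filterlim_at_top)
          then show "\<forall>\<^sub>F n in sequentially. \<forall>z\<in>K. M \<le> cmod (g (\<sigma> n) z)"
          proof eventually_elim
            case (elim n)
            show ?case
            proof
              fix z assume "z \<in> K"
              then show "M \<le> cmod (g (\<sigma> n) z)"
                unfolding f using K elim U(3) by (intro N[of m]) (auto simp del: seq_iter.simps)
            qed
          qed
        qed
      qed
    qed
  qed
  then show ?thesis using U(1,2) by (auto simp: julia_def)
qed

text \<open>All iterates are bounded by \<open>R\<close> there, so Montel's theorem applies.\<close>

lemma julia_disjoint_interior_filled:
  assumes "z \<in> interior (filled R \<omega>)"
  shows "z \<notin> julia \<omega>"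
proof -
  let ?F = "\<lambda>n. seq_iter \<omega> (Suc n)" and ?U = "interior (filled R \<omega>)"
  have "normal_family (range ?F) ?U"
    unfolding normal_family_def
  proof (intro allI impI)
    fix g :: "nat \<Rightarrow> complex \<Rightarrow> complex" assume g: "\<forall>n. g n \<in> range ?F"
    obtain h \<sigma> where "strict_mono (\<sigma> :: nat \<Rightarrow> nat)"
      "\<And>K. \<lbrakk>compact K; K \<subseteq> ?U\<rbrakk> \<Longrightarrow> uniform_limit K (g \<circ> \<sigma>) h sequentially"
    proof (rule Montel[of ?U "range ?F" g])
      show "h holomorphic_on ?U" if "h \<in> range ?F" for h
        using that by (auto intro!: holomorphic_intros simp del: seq_iter.simps)
      show "\<exists>B. \<forall>h\<in>range ?F. \<forall>z\<in>K. cmod (h z) \<le> B" if "K \<subseteq> ?U" for K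
      proof (intro exI[of _ R] ballI)
        fix h z assume "h \<in> range ?F" "z \<in> K"
        then show "cmod (h z) \<le> R"
          using that interior_subset[of "filled R \<omega>"] unfolding filled_def by blast
      qed
    qed (use g in auto)
    then show "\<exists>\<sigma>. strict_mono \<sigma> \<and>
        ((\<exists>h. \<forall>K. compact K \<and> K \<subseteq> ?U \<longrightarrow> uniform_limit K (\<lambda>n. g (\<sigma> n)) h sequentially) \<or>
         (\<forall>K. compact K \<and> K \<subseteq> ?U \<longrightarrow> (\<forall>M. \<forall>\<^sub>F n in sequentially. \<forall>z\<in>K. M \<le> cmod (g (\<sigma> n) z))))"
      unfolding o_def by blast
  qed
  then show ?thesis using assms by (auto simp: julia_def)
qed

text \<open>Near \<open>z\<close>, whose orbit is bounded, there is an escaping point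
  \<open>y\<close>. A finite limit is impossible at \<open>y\<close>, and divergence to infinity is
  impossible at \<open>z\<close>.\<close>

lemma frontier_filled_subset_julia:
  assumes \<omega>: "admissible R \<omega>" and z: "z \<in> frontier (filled R \<omega>)"
  shows "z \<in> julia \<omega>"
proof (rule ccontr)
  let ?F = "\<lambda>n. seq_iter \<omega> (Suc n)"
  assume "z \<notin> julia \<omega>"
  then obtain U where U: "open U" "z \<in> U" "normal_family (range ?F) U"
    by (auto simp: julia_def simp del: seq_iter.simps)
  have zK: "z \<in> filled R \<omega>"
    using z compact_imp_closed[OF compact_filled[OF \<omega>]] frontier_subset_closed by blast
  obtain e where e: "e > 0" "cball z e \<subseteq> U" using U(1,2) open_contains_cball by blast
  have "ball z e - filled R \<omega> \<noteq> {}"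
    using z e(1) unfolding frontier_straddle by force
  then obtain y where y: "y \<in> cball z e" "y \<notin> filled R \<omega>" by force
  from y(2) obtain m where m: "R < cmod (seq_iter \<omega> m y)" by (auto simp: filled_def not_le)
  obtain \<sigma> where \<sigma>: "strict_mono (\<sigma> :: nat \<Rightarrow> nat)" and
    alt: "(\<exists>h. \<forall>K. compact K \<and> K \<subseteq> U \<longrightarrow> uniform_limit K (\<lambda>n. ?F (\<sigma> n)) h sequentially) \<or>
         (\<forall>K. compact K \<and> K \<subseteq> U \<longrightarrow> (\<forall>M. \<forall>\<^sub>F n in sequentially. \<forall>z\<in>K. M \<le> cmod (?F (\<sigma> n) z)))"
    using U(3)[unfolded normal_family_def, rule_format, of ?F] by blast
  have bd: "cmod (?F n z) \<le> R" for n using zK unfolding filled_def by blast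
  from alt show False
  proof
    assume "\<exists>h. \<forall>K. compact K \<and> K \<subseteq> U \<longrightarrow> uniform_limit K (\<lambda>n. ?F (\<sigma> n)) h sequentially"
    then obtain h where h: "\<forall>K. compact K \<and> K \<subseteq> U \<longrightarrow> uniform_limit K (\<lambda>n. ?F (\<sigma> n)) h sequentially" ..
    have "uniform_limit (cball z e) (\<lambda>n. ?F (\<sigma> n)) h sequentially"
      using h e(2) compact_cball by (simp del: seq_iter.simps)
    then have "(\<lambda>n. ?F (\<sigma> n) y) \<longlonglongrightarrow> h y" using y(1) by (rule tendsto_uniform_limitI)
    moreover have "filterlim (\<lambda>n. ?F (\<sigma> n) y) at_infinity sequentially"
    proof (rule filterlim_compose[OF seq_iter_tendsto_infinity[OF \<omega> m]])
      show "filterlim (\<lambda>n. Suc (\<sigma> n)) sequentially sequentially"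
        using filterlim_compose[OF filterlim_Suc filterlim_subseq[OF \<sigma>]] .
    qed
    ultimately show False using not_tendsto_and_filterlim_at_infinity by force
  next
    assume "\<forall>K. compact K \<and> K \<subseteq> U \<longrightarrow> (\<forall>M. \<forall>\<^sub>F n in sequentially. \<forall>z\<in>K. M \<le> cmod (?F (\<sigma> n) z))"
    from this[rule_format, of "{z}" "R + 1"]
    have "\<forall>\<^sub>F n in sequentially. \<forall>z\<in>{z}. R + 1 \<le> cmod (?F (\<sigma> n) z)"
      using U(2) by (simp del: seq_iter.simps)
    then obtain n where "R + 1 \<le> cmod (?F (\<sigma> n) z)"
      using eventually_happens'[OF sequentially_bot] by (auto simp del: seq_iter.simps)
    then show False using bd[of "\<sigma> n"] by linarith
  qed
qed

lemma julia_eq_frontier_filled: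
  assumes "admissible R \<omega>"
  shows "julia \<omega> = frontier (filled R \<omega>)"
proof -
  have "filled R \<omega> - interior (filled R \<omega>) = frontier (filled R \<omega>)"
    using compact_imp_closed[OF compact_filled[OF assms]] by (simp add: frontier_def)
  then show ?thesis
    using julia_subset_filled[OF assms] julia_disjoint_interior_filled[of _ R \<omega>]
      frontier_filled_subset_julia[OF assms] by blast
qed

subsection \<open>Connected Julia sets\<close>

text \<open>As the critical value lies in \<open>E\<close>, the critical point 0 lies in the
  preimage. A separation of the preimage is made symmetric under negation, with 0 in one part; the
  fibres being \<open>{z, - z}\<close>, the images of the symmetric parts separate
  \<open>E\<close>.\<close>

lemma connected_vimage_fq:
  assumes "compact E" "connected E" "c \<in> E"
  shows "compact (fq c -` E)" "connected (fq c -` E)"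
proof -
  let ?S = "fq c -` E"
  have cont: "continuous_on A (fq c)" for A unfolding fq_def by (intro continuous_intros)
  have clS: "closed ?S"
    by (rule closed_vimage[OF compact_imp_closed[OF assms(1)] cont])
  obtain M where M: "\<And>w. w \<in> E \<Longrightarrow> cmod w \<le> M"
    using compact_imp_bounded[OF assms(1)] unfolding bounded_iff by blast
  have "?S \<subseteq> cball 0 (sqrt (M + cmod c))"
  proof
    fix z assume "z \<in> ?S"
    then have "cmod (fq c z) \<le> M" using M by simp
    moreover have "cmod (z^2) \<le> cmod (fq c z) + cmod c"
      unfolding fq_def using norm_triangle_ineq4[of "z^2 + c" c] by simp
    ultimately have "cmod z ^ 2 \<le> M + cmod c" by (simp add: norm_power)
    then show "z \<in> cball 0 (sqrt (M + cmod c))" by (simp add: real_le_rsqrt)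
  qed
  then have "bounded ?S" using bounded_cball bounded_subset by blast
  then show cptS: "compact ?S" using clS compact_eq_bounded_closed by blast
  have 0: "0 \<in> ?S" using assms(3) by (simp add: fq_def)
  have sym: "- z \<in> ?S \<longleftrightarrow> z \<in> ?S" for z by (simp add: fq_def)
  have sep: False if AB: "closed A" "closed B" "?S \<subseteq> A \<union> B" "A \<inter> B \<inter> ?S = {}" "0 \<in> A" "B \<inter> ?S \<noteq> {}" for A B
  proof -
    define A' where "A' = ?S \<inter> A"
    define B' where "B' = ?S \<inter> B"
    have cA: "compact A'" "compact (uminus ` A')" and cB: "compact B'" "compact (uminus ` B')"
      using cptS AB unfolding A'_def B'_def
      by (auto intro!: compact_Int_closed compact_continuous_image continuous_intros)
    \<comment> \<open>Points whose negative falls on the other side all go to \<open>B1\<close>. The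
      part \<open>A1\<close> remains nonempty because 0 is its own negative.\<close>
    define A1 where "A1 = A' \<inter> uminus ` A'"
    define B1 where "B1 = B' \<union> uminus ` B'"
    have mem: "z \<in> uminus ` X \<longleftrightarrow> - z \<in> X" for z and X :: "complex set"
      by (metis image_iff minus_minus)
    have "z \<in> A1 \<union> B1 \<longleftrightarrow> z \<in> ?S" and "\<not> (z \<in> A1 \<and> z \<in> B1)" for z
      using sym[of z] AB(3,4) unfolding A1_def B1_def A'_def B'_def Un_iff Int_iff mem by blast+
    then have cover: "A1 \<union> B1 = ?S" and disj: "A1 \<inter> B1 = {}" by blast+
    have sA: "- z \<in> A1" if "z \<in> A1" for z using that by (auto simp: A1_def mem)
    have "compact A1" "compact B1"
      unfolding A1_def B1_def using cA cB by (auto intro: compact_Int compact_Un)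
    then have cl: "closed (fq c ` A1)" "closed (fq c ` B1)"
      by (auto intro!: compact_imp_closed compact_continuous_image cont)
    have img: "fq c ` A1 \<union> fq c ` B1 = E"
      using cover surj_fq[of c] by (metis image_Un surj_image_vimage_eq)
    have "fq c ` A1 \<inter> fq c ` B1 = {}"
    proof safe
      fix z w assume "z \<in> A1" "w \<in> B1" "fq c z = fq c w"
      then have "w = z \<or> w = - z" by (auto simp: fq_def power2_eq_iff)
      then show "fq c z \<in> {}" using sA[OF \<open>z \<in> A1\<close>] \<open>z \<in> A1\<close> \<open>w \<in> B1\<close> disj by blast
    qed
    moreover have "0 \<in> A1" using 0 AB(5) by (auto simp: A1_def A'_def mem)
    moreover have "B1 \<noteq> {}" using AB(6) by (auto simp: B1_def B'_def)
    ultimately have "closed (fq c ` A1) \<and> closed (fq c ` B1) \<and> E \<subseteq> fq c ` A1 \<union> fq c ` B1 \<and>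
      fq c ` A1 \<inter> fq c ` B1 \<inter> E = {} \<and> fq c ` A1 \<inter> E \<noteq> {} \<and> fq c ` B1 \<inter> E \<noteq> {}"
      using cl unfolding img[symmetric] by auto
    then show False using assms(2) unfolding connected_closed by (metis (no_types))
  qed
  show "connected ?S"
    unfolding connected_closed
  proof (rule notI, elim exE conjE)
    fix A B assume AB: "closed A" "closed B" "?S \<subseteq> A \<union> B" "A \<inter> B \<inter> ?S = {}"
      "A \<inter> ?S \<noteq> {}" "B \<inter> ?S \<noteq> {}"
    show False
    proof (cases "0 \<in> A")
      case True
      with sep[of A B] AB show False by blast
    next
      case False
      then have "0 \<in> B" using 0 AB(3) by blast
      with sep[of B A] AB show False by blast
    qed
  qed
qed

lemma connected_seq_iter_le:
  assumes "admissible R \<omega>" "\<And>j. j < n \<Longrightarrow> cmod (seq_iter (shiftseq j \<omega>) (n - j) 0) \<le> R"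
  shows "connected {z. cmod (seq_iter \<omega> n z) \<le> R}"
  using assms
proof (induction n arbitrary: \<omega>)
  case 0
  have "{z. cmod (seq_iter \<omega> 0 z) \<le> R} = cball 0 R" by auto
  then show ?case by simp
next
  case (Suc n)
  let ?E = "{z. cmod (seq_iter (shiftseq 1 \<omega>) n z) \<le> R}"
  have eq: "{z. cmod (seq_iter \<omega> (Suc n) z) \<le> R} = fq (\<omega> 0) -` ?E"
    by (simp only: seq_iter_Suc_shift vimage_Collect_eq)
  show ?case
    unfolding eq
  proof (rule connected_vimage_fq)
    show "compact ?E" using Suc.prems by (intro compact_seq_iter_le) simp
    show "connected ?E"
    proof (rule Suc.IH)
      fix j assume "j < n"
      then show "cmod (seq_iter (shiftseq j (shiftseq 1 \<omega>)) (n - j) 0) \<le> R"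
        using Suc.prems(2)[of "Suc j"] unfolding shiftseq_shiftseq plus_1_eq_Suc diff_Suc_Suc by blast
    qed (use Suc.prems in simp)
    have "cmod (seq_iter \<omega> (Suc n) 0) \<le> R" using Suc.prems(2)[of 0] by simp
    then show "\<omega> 0 \<in> ?E" by (simp only: seq_iter_Suc_shift) (simp add: fq_def)
  qed
qed

lemma connected_filled:
  assumes "admissible R \<omega>" "\<And>j n. cmod (seq_iter (shiftseq j \<omega>) n 0) \<le> R"
  shows "connected (filled R \<omega>)"
  unfolding filled_eq_INT
proof (rule connected_nest)
  show "compact {z. cmod (seq_iter \<omega> n z) \<le> R}" for n by (rule compact_seq_iter_le[OF assms(1)])
  show "connected {z. cmod (seq_iter \<omega> n z) \<le> R}" for n
    by (rule connected_seq_iter_le[OF assms(1)]) (rule assms(2))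
  show "{z. cmod (seq_iter \<omega> n z) \<le> R} \<subseteq> {z. cmod (seq_iter \<omega> m z) \<le> R}" if "m \<le> n" for m n
    using seq_iter_le_mono[OF assms(1) _ that] by blast
qed

text \<open>A bounded complementary component has its boundary in the filled set, where every
  iterate is at most \<open>R\<close>; the maximum principle extends the bound to the
  component.\<close>

lemma connected_Compl_filled:
  assumes "admissible R \<omega>"
  shows "connected (- filled R \<omega>)"
proof (rule ccontr)
  let ?K = "filled R \<omega>"
  assume "\<not> connected (- ?K)"
  moreover have bK: "bounded ?K" and clK: "closed ?K"
    using compact_filled[OF assms] compact_imp_bounded compact_imp_closed by auto
  ultimately obtain C where C: "C \<in> components (- ?K)" "bounded C"
    using cobounded_has_bounded_component[of "- ?K"] by auto
  have "open C" using C(1) clK open_components by blast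
  have fr: "frontier C \<subseteq> ?K"
    using frontier_of_components_closed_complement[OF clK C(1)] frontier_subset_closed[OF clK] by blast
  obtain z where z: "z \<in> C" using in_components_nonempty[OF C(1)] by blast
  have "cmod (seq_iter \<omega> n z) \<le> R" for n
  proof (rule maximum_modulus_frontier[where S=C and f="seq_iter \<omega> n" and \<xi>=z])
    show "seq_iter \<omega> n holomorphic_on interior C" by (intro holomorphic_intros)
    show "continuous_on (closure C) (seq_iter \<omega> n)" by (intro continuous_intros)
    show "cmod (seq_iter \<omega> n w) \<le> R" if "w \<in> frontier C" for w
      using that fr unfolding filled_def by blast
  qed (use C z in auto)
  then have "z \<in> ?K" by (simp add: filled_def)
  then show False using z in_components_subset[OF C(1)] by blast
qed

lemma connected_julia:
  assumes "admissible R \<omega>" "\<And>j n. cmod (seq_iter (shiftseq j \<omega>) n 0) \<le> R"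
  shows "connected (julia \<omega>)"
  unfolding julia_eq_frontier_filled[OF assms(1)]
  by (intro connected_frontier_simple connected_filled connected_Compl_filled assms)

lemma connected_julia_not_totally_disconnected:
  assumes "admissible R \<omega>" "connected (julia \<omega>)"
  shows "\<not> totally_disconnected (julia \<omega>)"
proof
  assume td: "totally_disconnected (julia \<omega>)"
  obtain x y where xy: "x \<in> julia \<omega>" "y \<in> julia \<omega>" "x \<noteq> y"
    using frontier_filled_two_points[OF assms(1)] julia_eq_frontier_filled[OF assms(1)] by auto
  have "connected_component_set (julia \<omega>) x = julia \<omega>"
    using assms(2) xy(1) connected_iff_eq_connected_component_set by blast
  then show False using td xy by (auto simp: totally_disconnected_def)
qed

subsection \<open>Totally disconnected Julia sets\<close>

text \<open>By the maximum principle a loop in the component encloses only points of the sublevel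
  set, hence of the component, so its winding number about any point off the component is 0.\<close>

lemma simply_connected_component_norm_less:
  assumes F: "F holomorphic_on UNIV"
  shows "simply_connected (connected_component_set {z. cmod (F z) < \<rho>} w)" (is "simply_connected ?U")
proof -
  let ?S = "{z. cmod (F z) < \<rho>}"
  have cont: "continuous_on A F" for A
    using F holomorphic_on_imp_continuous_on continuous_on_subset by blast
  have "open ?S" by (intro open_Collect_less continuous_intros cont)
  then have oU: "open ?U" by (rule open_connected_component)
  have "winding_number p z = 0"
    if p: "path p" "path_image p \<subseteq> ?U" "pathfinish p = pathstart p" and z: "z \<notin> ?U" for p z
  proof -
    let ?T = "path_image p"
    have cT: "compact ?T" "connected ?T" "?T \<noteq> {}"
      using p by (auto simp: compact_path_image connected_path_image)
    have sub: "?T \<subseteq> ?S" using p(2) connected_component_subset by blast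
    \<comment> \<open>The maximum is attained on the compact loop, so the strict bound by
      \<open>\<rho>\<close> carries over to the inside.\<close>
    obtain t where t: "t \<in> ?T" "\<And>s. s \<in> ?T \<Longrightarrow> cmod (F s) \<le> cmod (F t)"
      using continuous_attains_sup[OF cT(1,3), of "\<lambda>s. cmod (F s)"] cont[of ?T] continuous_on_norm by blast
    have "cmod (F s) \<le> cmod (F t)" if s: "s \<in> inside ?T" for s
    proof (rule maximum_modulus_frontier[where S="inside ?T" and f=F and \<xi>=s])
      show "F holomorphic_on interior (inside ?T)" using F holomorphic_on_subset by blast
      show "bounded (inside ?T)" by (rule bounded_inside) (use cT compact_imp_bounded in blast)
      show "cmod (F q) \<le> cmod (F t)" if "q \<in> frontier (inside ?T)" for q
        using that t(2) frontier_inside_subset[of ?T] compact_imp_closed[OF cT(1)] by blast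
    qed (use s cont in auto)
    moreover have "cmod (F t) < \<rho>" using sub t(1) by blast
    ultimately have "?T \<union> inside ?T \<subseteq> ?S" using sub by force
    moreover have "connected (?T \<union> inside ?T)"
      by (rule connected_with_inside) (use cT compact_imp_closed in auto)
    moreover have "t \<in> ?U" using t(1) p(2) by blast
    ultimately have "?T \<union> inside ?T \<subseteq> ?U"
      using connected_component_maximal[of t "?T \<union> inside ?T" ?S] t(1)
        connected_component_eq[of t ?S w] by auto
    then have "z \<in> outside ?T" using z inside_Un_outside[of ?T] by blast
    then show ?thesis by (intro winding_number_zero_in_outside p)
  qed
  then show ?thesis using simply_connected_eq_winding_number_zero[OF oU] connected_connected_component by blast
qed

text \<open>The bound is uniform in the sequence, which makes the fixed-length iterates started at
  varying times a normal family.\<close>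

lemma seq_iter_bounded_on_cball:
  "\<exists>B. \<forall>\<omega> z. admissible R \<omega> \<longrightarrow> cmod z \<le> \<rho> \<longrightarrow> cmod (seq_iter \<omega> n z) \<le> B"
proof (induction n)
  case 0
  then show ?case by (intro exI[of _ \<rho>]) simp
next
  case (Suc n)
  then obtain B where B: "\<And>\<omega> z. admissible R \<omega> \<Longrightarrow> cmod z \<le> \<rho> \<Longrightarrow> cmod (seq_iter \<omega> n z) \<le> B" by blast
  show ?case
  proof (intro exI[of _ "B^2 + R"] allI impI)
    fix \<omega> z assume \<omega>: "admissible R \<omega>" and z: "cmod z \<le> \<rho>"
    have "cmod (seq_iter \<omega> (Suc n) z) \<le> cmod (seq_iter \<omega> n z) ^ 2 + cmod (\<omega> n)"
      by (simp add: fq_def norm_triangle_le norm_power)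
    also have "\<dots> \<le> B^2 + R"
      using B[OF \<omega> z] spec[OF \<omega>[unfolded admissible_def], of n] by (intro add_mono power_mono) auto
    finally show "cmod (seq_iter \<omega> (Suc n) z) \<le> B^2 + R" .
  qed
qed

text \<open>Suppose that at infinitely many times \<open>k\<close> every earlier critical point has left the disc by
  time \<open>k + m\<close>. Then \<open>f\<^sup>(\<^sup>k\<^sup>)\<close> has univalent inverse branches on the components of the sublevel set of the
  next \<open>m + 1\<close> iterates. A locally uniform limit of such branches takes values in the filled Julia set,
  so it is constant if the latter has no interior.\<close>

lemma filled_connected_subset_trivial:
  assumes \<omega>: "admissible R \<omega>" and int: "interior (filled R \<omega>) = {}"
    and inf: "\<exists>\<^sub>\<infinity>k. \<forall>j<k. R < cmod (seq_iter (shiftseq j \<omega>) (k + m - j) 0)"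
    and C: "connected C" "C \<subseteq> filled R \<omega>" "x \<in> C" "y \<in> C"
  shows "x = y"
proof -
  have R: "R \<ge> 2" by (rule admissible_ge_2[OF \<omega>])
  \<comment> \<open>One step beyond \<open>m\<close> improves the escape bound from \<open>R\<close>
    to \<open>2 * R\<close>, which leaves room for the thresholds \<open>5 * R / 4\<close> and
    \<open>3 * R / 2\<close>.\<close>
  define M where "M = Suc m"
  define A where "A = {k. \<forall>j<k. R < cmod (seq_iter (shiftseq j \<omega>) (k + m - j) 0)}"
  have "infinite A" using inf by (simp add: A_def frequently_cofinite)
  define \<kappa> where "\<kappa> = enumerate A"
  have \<kappa>: "strict_mono \<kappa>" "\<And>i. \<kappa> i \<in> A"
    using \<open>infinite A\<close> by (auto simp: \<kappa>_def strict_mono_enumerate enumerate_in_set)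
  have crit: "2 * R \<le> cmod (seq_iter (shiftseq j \<omega>) (k + M - j) 0)" if "k \<in> A" "j < k" for j k
  proof -
    have "R < cmod (seq_iter (shiftseq j \<omega>) (k + m - j) 0)" using that by (simp add: A_def)
    from seq_iter_growth[OF _ this, of 1] \<omega> that show ?thesis by (simp add: M_def Suc_diff_le)
  qed
  define F where "F k = seq_iter (shiftseq k \<omega>) M" for k
  \<comment> \<open>The \<open>M\<close>-step maps vary with their starting time. Passing to a limit
    \<open>G\<close> yields sublevel sets that serve for all chosen times.\<close>
  obtain G \<sigma> where G: "G holomorphic_on UNIV" and \<sigma>: "strict_mono (\<sigma> :: nat \<Rightarrow> nat)"
    and ptG: "\<And>z. z \<in> UNIV \<Longrightarrow> (\<lambda>n. F (\<kappa> (\<sigma> n)) z) \<longlonglongrightarrow> G z"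
    and unG: "\<And>K. compact K \<Longrightarrow> K \<subseteq> UNIV \<Longrightarrow> uniform_limit K ((\<lambda>n. F (\<kappa> n)) \<circ> \<sigma>) G sequentially"
  proof (rule Montel[of UNIV "range F" "\<lambda>n. F (\<kappa> n)"])
    show "h holomorphic_on UNIV" if "h \<in> range F" for h
      using that unfolding F_def by (auto intro!: holomorphic_intros)
    fix K :: "complex set" assume "compact K"
    then obtain \<rho> where \<rho>: "\<And>z. z \<in> K \<Longrightarrow> cmod z \<le> \<rho>" using compact_imp_bounded bounded_iff by metis
    obtain B where "\<And>\<omega> z. admissible R \<omega> \<Longrightarrow> cmod z \<le> \<rho> \<Longrightarrow> cmod (seq_iter \<omega> M z) \<le> B"
      using seq_iter_bounded_on_cball by blast
    then show "\<exists>B. \<forall>h\<in>range F. \<forall>z\<in>K. cmod (h z) \<le> B"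
      using \<rho> \<omega> unfolding F_def by (intro exI[of _ B]) auto
  qed auto
  have contG: "continuous_on X G" for X
    using G holomorphic_on_imp_continuous_on continuous_on_subset by blast
  have Fbig: "2 * R \<le> cmod (F k z)" if "R \<le> cmod z" for k z
  proof -
    have "2 * R \<le> 2 ^ M * cmod z" unfolding M_def using that R
      by (intro mult_mono) (auto simp: self_le_power)
    also have "\<dots> \<le> cmod (F k z)" unfolding F_def using \<omega> that by (intro seq_iter_escape) auto
    finally show ?thesis .
  qed
  have Gbig: "2 * R \<le> cmod (G z)" if "R \<le> cmod z" for z
    by (rule tendsto_lowerbound[OF tendsto_norm[OF ptG[OF UNIV_I]]])
       (use Fbig[OF that] in auto)
  \<comment> \<open>With an error of \<open>R / 4\<close> between \<open>F\<close> and
    \<open>G\<close> on the disc, points of \<open>C\<close> have \<open>cmod F \<le> R\<close> and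
    land in \<open>Q0\<close>, while critical orbits have \<open>cmod F \<ge> 2 * R\<close> and miss
    \<open>S\<close>.\<close>
  define S where "S = {z. cmod (G z) < 3 * R / 2}"
  define Q0 where "Q0 = {z. cmod (G z) \<le> 5 * R / 4}"
  have SR: "cmod z < R" if "z \<in> S" for z
    using that Gbig[of z] R unfolding S_def by fastforce
  have Q0S: "Q0 \<subseteq> S" using R by (auto simp: Q0_def S_def)
  have openS: "open S" unfolding S_def by (intro open_Collect_less continuous_intros contG)
  have clQ0: "closed Q0" unfolding Q0_def by (intro closed_Collect_le continuous_intros contG)
  have "Q0 \<subseteq> ball 0 R" using Q0S SR by auto
  then have cQ0: "compact Q0"
    using clQ0 bounded_subset[OF bounded_ball] compact_eq_bounded_closed by blast
  have "\<forall>\<^sub>F n in sequentially. \<forall>z\<in>cball 0 R. dist (((\<lambda>n. F (\<kappa> n)) \<circ> \<sigma>) n z) (G z) < R / 4"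
    by (rule uniform_limitD[OF unG]) (use R in auto)
  then obtain N where N: "\<And>n z. n \<ge> N \<Longrightarrow> cmod z \<le> R \<Longrightarrow> dist (F (\<kappa> (\<sigma> n)) z) (G z) < R / 4"
    unfolding eventually_sequentially o_def by (metis mem_cball_0)
  define \<alpha> where "\<alpha> n = \<kappa> (\<sigma> (n + N))" for n
  have \<alpha>: "strict_mono \<alpha>" "\<And>n. \<alpha> n \<in> A"
    "\<And>n z. cmod z \<le> R \<Longrightarrow> dist (F (\<alpha> n) z) (G z) < R / 4"
    using \<kappa> \<sigma> N by (auto simp: \<alpha>_def strict_mono_def)
  let ?f = "\<lambda>n. seq_iter \<omega> (\<alpha> n)"
  have inQ0: "?f n w \<in> Q0" if "w \<in> C" for n w
  proof -
    have le: "cmod (seq_iter \<omega> k w) \<le> R" for k using that C(2) by (auto simp: filled_def)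
    have "F (\<alpha> n) (?f n w) = seq_iter \<omega> (\<alpha> n + M) w" by (simp add: F_def seq_iter_add)
    then have "cmod (F (\<alpha> n) (?f n w)) \<le> R" using le by simp
    moreover have "cmod (G (?f n w)) \<le> cmod (F (\<alpha> n) (?f n w)) + dist (F (\<alpha> n) (?f n w)) (G (?f n w))"
      by (metis dist_norm norm_minus_commute norm_triangle_sub)
    ultimately show ?thesis using \<alpha>(3)[OF le, of n "\<alpha> n"] by (simp add: Q0_def)
  qed
  \<comment> \<open>Along a convergent subsequence the images of \<open>x\<close> eventually lie in
    a single component \<open>U\<close> of \<open>S\<close>; connectedness of \<open>C\<close>
    carries all its images there.\<close>
  obtain w \<tau> where w: "w \<in> Q0" and \<tau>: "strict_mono (\<tau> :: nat \<Rightarrow> nat)" "((\<lambda>n. ?f n x) \<circ> \<tau>) \<longlonglongrightarrow> w"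
    using cQ0[unfolded compact_def, rule_format, of "\<lambda>n. ?f n x"] inQ0[OF C(3)] by blast
  define U where "U = connected_component_set S w"
  have wU: "w \<in> U" using w Q0S unfolding U_def by auto
  have oU: "open U" unfolding U_def by (rule open_connected_component[OF openS])
  have US: "U \<subseteq> S" unfolding U_def by (rule connected_component_subset)
  have scU: "simply_connected U" unfolding U_def S_def by (rule simply_connected_component_norm_less[OF G])
  have conU: "connected U" unfolding U_def by (rule connected_connected_component)
  obtain N' where N': "\<And>n. n \<ge> N' \<Longrightarrow> ?f (\<tau> n) x \<in> U"
    using topological_tendstoD[OF \<tau>(2) oU wU] unfolding eventually_sequentially by auto
  define \<beta> where "\<beta> n = \<alpha> (\<tau> (n + N'))" for n
  have \<beta>: "strict_mono \<beta>" using \<alpha>(1) \<tau>(1) by (auto simp: \<beta>_def strict_mono_def)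
  let ?g = "\<lambda>n. seq_iter \<omega> (\<beta> n)"
  define Q where "Q = Q0 \<inter> U"
  have QU: "Q \<subseteq> U" by (simp add: Q_def)
  \<comment> \<open>A component is relatively closed in \<open>S\<close>, and \<open>Q0\<close> is a
    compact subset of \<open>S\<close>.\<close>
  have cQ: "compact Q"
  proof -
    obtain T where "closed T" "U = S \<inter> T"
      using closedin_connected_component[of S w] unfolding U_def closedin_closed by blast
    then have "Q = Q0 \<inter> T" using Q0S by (auto simp: Q_def)
    then show ?thesis using cQ0 \<open>closed T\<close> by (simp add: compact_Int_closed)
  qed
  have inQ: "?g n v \<in> Q" if "v \<in> C" for n v
  proof -
    have "?g n ` C \<subseteq> U"
      unfolding U_def
    proof -
      have "connected (?g n ` C)" by (intro connected_continuous_image continuous_intros C)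
      moreover have "?g n ` C \<subseteq> S" using inQ0 Q0S by (auto simp: \<beta>_def)
      moreover have "?g n x \<in> ?g n ` C" using C(3) by blast
      ultimately have "?g n ` C \<subseteq> connected_component_set S (?g n x)"
        by (intro connected_component_maximal)
      moreover have "?g n x \<in> connected_component_set S w" using N'[of "n + N'"] by (simp add: \<beta>_def U_def)
      ultimately show "?g n ` C \<subseteq> connected_component_set S w" using connected_component_eq by blast
    qed
    then show ?thesis using inQ0 that by (auto simp: Q_def \<beta>_def)
  qed
  have "\<exists>h. h holomorphic_on U \<and> (\<forall>u\<in>U. ?g n (h u) = u) \<and> (\<forall>v\<in>C. h (?g n v) = v)" for n
  proof (rule inverse_branch[OF oU scU C(1)])
    show "C \<noteq> {}" using C(3) by blast
    show "\<forall>v\<in>C. ?g n v \<in> U" using inQ QU by blast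
    show "\<forall>j<\<beta> n. seq_iter (shiftseq j \<omega>) (\<beta> n - j) 0 \<notin> U"
    proof (intro allI impI notI)
      fix j assume j: "j < \<beta> n" and vU: "seq_iter (shiftseq j \<omega>) (\<beta> n - j) 0 \<in> U"
      let ?v = "seq_iter (shiftseq j \<omega>) (\<beta> n - j) 0"
      have vS: "?v \<in> S" using vU US by blast
      have "F (\<beta> n) ?v = seq_iter (shiftseq j \<omega>) (\<beta> n - j + M) 0"
        using j seq_iter_add[of "shiftseq j \<omega>" "\<beta> n - j" M 0] by (simp add: F_def)
      also have "\<beta> n - j + M = \<beta> n + M - j" using j by simp
      finally have "2 * R \<le> cmod (F (\<beta> n) ?v)" using crit[of "\<beta> n" j] \<alpha>(2) j by (simp add: \<beta>_def)
      moreover have "dist (F (\<beta> n) ?v) (G ?v) < R / 4"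
        unfolding \<beta>_def by (rule \<alpha>(3)) (use SR[OF vS] in \<open>simp add: \<beta>_def\<close>)
      moreover have "cmod (F (\<beta> n) ?v) \<le> cmod (G ?v) + dist (F (\<beta> n) ?v) (G ?v)"
        by (metis dist_norm norm_triangle_sub)
      ultimately show False using vS R by (simp add: S_def)
    qed
  qed
  then obtain h where h: "\<And>n. h n holomorphic_on U" "\<And>n u. u \<in> U \<Longrightarrow> ?g n (h n u) = u"
    "\<And>n v. v \<in> C \<Longrightarrow> h n (?g n v) = v" by metis
  have hR: "cmod (h n u) \<le> R" if "u \<in> U" for n u
    using seq_iter_ge[OF \<omega>, of "h n u" "\<beta> n"] h(2)[OF that, of n] SR[of u] US that by fastforce
  obtain H \<rho> where H: "H holomorphic_on U" and \<rho>: "strict_mono (\<rho> :: nat \<Rightarrow> nat)"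
    and ptH: "\<And>u. u \<in> U \<Longrightarrow> (\<lambda>n. h (\<rho> n) u) \<longlonglongrightarrow> H u"
    and unH: "\<And>K. compact K \<Longrightarrow> K \<subseteq> U \<Longrightarrow> uniform_limit K (h \<circ> \<rho>) H sequentially"
  proof (rule Montel[of U "range h" h])
    show "\<exists>B. \<forall>f\<in>range h. \<forall>z\<in>K. cmod (f z) \<le> B" if "K \<subseteq> U" for K
      by (intro exI[of _ R]) (use hR that in blast)
  qed (use oU h in auto)
  have contH: "continuous_on U H" using H by (rule holomorphic_on_imp_continuous_on)
  \<comment> \<open>The images of \<open>v\<close> stay in the compact set \<open>Q\<close>, and the
    branches bring them back to \<open>v\<close>; uniform convergence on \<open>Q\<close> passes
    this to \<open>H\<close>.\<close>
  have HQ: "v \<in> H ` Q" if v: "v \<in> C" for v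
  proof -
    have "closed (H ` Q)"
      by (intro compact_imp_closed compact_continuous_image cQ continuous_on_subset[OF contH QU])
    moreover have "v \<in> closure (H ` Q)"
      unfolding closure_approachable
    proof (intro allI impI)
      fix e :: real assume "e > 0"
      then have "\<forall>\<^sub>F n in sequentially. \<forall>u\<in>Q. dist ((h \<circ> \<rho>) n u) (H u) < e"
        by (intro uniform_limitD[OF unH[OF cQ QU]])
      then obtain n where "\<forall>u\<in>Q. dist ((h \<circ> \<rho>) n u) (H u) < e"
        using eventually_happens'[OF sequentially_bot] by blast
      then have "dist (h (\<rho> n) (?g (\<rho> n) v)) (H (?g (\<rho> n) v)) < e" using inQ[OF v, of "\<rho> n"] by auto
      then show "\<exists>y\<in>H ` Q. dist y v < e"
        using h(3)[OF v] inQ[OF v, of "\<rho> n"] by (metis dist_commute imageI)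
    qed
    ultimately show ?thesis by (simp add: closure_closed)
  qed
  \<comment> \<open>The orbit of \<open>h (\<rho> i) u\<close> is still within radius
    \<open>R\<close> at time \<open>\<beta> (\<rho> i) \<ge> i\<close>, hence at all earlier times;
    the bound passes to the limit at each fixed time.\<close>
  have HK: "H u \<in> filled R \<omega>" if u: "u \<in> U" for u
    unfolding filled_def
  proof (intro CollectI allI)
    fix n
    have lim: "(\<lambda>i. seq_iter \<omega> n (h (\<rho> i) u)) \<longlonglongrightarrow> seq_iter \<omega> n (H u)"
    proof (rule continuous_on_tendsto_compose[OF _ ptH[OF u]])
      show "continuous_on UNIV (seq_iter \<omega> n)" by (intro continuous_intros)
    qed auto
    have "\<forall>\<^sub>F i in sequentially. cmod (seq_iter \<omega> n (h (\<rho> i) u)) \<le> R"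
      using eventually_ge_at_top[of n]
    proof eventually_elim
      case (elim i)
      have "i \<le> \<beta> (\<rho> i)" using seq_suble[OF \<rho>, of i] seq_suble[OF \<beta>, of "\<rho> i"] by linarith
      moreover have "cmod (?g (\<rho> i) (h (\<rho> i) u)) \<le> R" using h(2)[OF u] SR US u by fastforce
      ultimately show ?case using seq_iter_le_mono[OF \<omega>, of "\<beta> (\<rho> i)" "h (\<rho> i) u" n] elim by simp
    qed
    then show "cmod (seq_iter \<omega> n (H u)) \<le> R"
      by (intro tendsto_upperbound[OF tendsto_norm[OF lim]]) auto
  qed
  show "x = y"
  proof (rule ccontr)
    assume "x \<noteq> y"
    then have "\<not> H constant_on U"
      using HQ[OF C(3)] HQ[OF C(4)] QU unfolding constant_on_def by (metis imageE subsetD)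
    then have "open (H ` U)" by (intro open_mapping_thm[OF H oU conU oU]) auto
    moreover have "H ` U \<subseteq> filled R \<omega>" using HK by blast
    ultimately have "H ` U \<subseteq> interior (filled R \<omega>)" by (simp add: interior_maximal)
    then show False using int wU by blast
  qed
qed

lemma julia_totally_disconnected:
  assumes \<omega>: "admissible R \<omega>" and int: "interior (filled R \<omega>) = {}"
    and inf: "\<exists>\<^sub>\<infinity>k. \<forall>j<k. R < cmod (seq_iter (shiftseq j \<omega>) (k + m - j) 0)"
  shows "totally_disconnected (julia \<omega>)"
  unfolding totally_disconnected_def
proof
  fix x assume x: "x \<in> julia \<omega>"
  have eq: "julia \<omega> = filled R \<omega>"
    using julia_eq_frontier_filled[OF \<omega>] int compact_imp_closed[OF compact_filled[OF \<omega>]]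
    by (simp add: frontier_def)
  have "y = x" if "y \<in> connected_component_set (julia \<omega>) x" for y
    by (rule filled_connected_subset_trivial[OF \<omega> int inf connected_connected_component _ that])
       (use x connected_component_subset eq in auto)
  then show "connected_component_set (julia \<omega>) x = {x}" using x by auto
qed

subsection \<open>Escape probabilities\<close>

lemma sets_mu [simp, measurable_cong]: "sets (mu c r) = sets borel"
  by (simp add: mu_def)

lemma space_mu [simp]: "space (mu c r) = UNIV"
  by (simp add: mu_def)

lemma emeasure_lborel_cball_pos: "r > 0 \<Longrightarrow> emeasure lborel (cball (c::complex) r) > 0"
  using content_cball_pos[of r c] emeasure_lborel_cball_finite[of c r]
  by (simp add: emeasure_eq_ennreal_measure top.not_eq_extremum)

lemma prob_space_mu:
  assumes "r > 0" shows "prob_space (mu c r)"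
proof -
  have "emeasure lborel (cball c r) \<noteq> \<infinity>" using emeasure_lborel_cball_finite[of c r] by simp
  then show ?thesis
    unfolding mu_def using assms emeasure_lborel_cball_pos[OF assms, of c]
    by (auto intro!: prob_space_uniform_measure)
qed

lemma AE_mu_cball:
  assumes "r > 0" shows "AE x in mu c r. x \<in> cball c r"
  unfolding mu_def using assms by (auto intro!: AE_uniform_measureI)

lemma mu_ball_pos:
  assumes "r > 0" "a \<in> cball c r" "\<delta> > 0"
  shows "emeasure (mu c r) (ball a \<delta>) > 0"
proof -
  have "a \<in> closure (ball c r)" using assms by (simp add: closure_ball)
  then obtain b where b: "b \<in> ball c r" "dist b a < \<delta>"
    using \<open>\<delta> > 0\<close> unfolding closure_approachable by blast
  then have "open (ball c r \<inter> ball a \<delta>)" "b \<in> ball c r \<inter> ball a \<delta>" by (auto simp: dist_commute)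
  then obtain e where e: "e > 0" "cball b e \<subseteq> ball c r \<inter> ball a \<delta>"
    unfolding open_contains_cball by blast
  have "0 < emeasure lborel (cball b e)" using e(1) by (rule emeasure_lborel_cball_pos)
  also have "\<dots> \<le> emeasure lborel (cball c r \<inter> ball a \<delta>)"
    using e(2) by (intro emeasure_mono) auto
  finally have "0 < emeasure lborel (cball c r \<inter> ball a \<delta>)" .
  moreover have "emeasure lborel (cball c r) \<noteq> \<infinity>" using emeasure_lborel_cball_finite[of c r] by simp
  ultimately show ?thesis
    unfolding mu_def using \<open>r > 0\<close> by (simp add: ennreal_zero_less_divide top.not_eq_extremum)
qed

text \<open>The probability that the orbit of \<open>z\<close> under independent noise with law
  \<open>M\<close> is within radius \<open>R\<close> after \<open>n\<close> steps. Conditioning on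
  the first parameter makes it a function of \<open>z\<close> on which estimates go by induction;
  \<open>emeasure_survive\<close> links it to the product measure.\<close>

fun survival :: "complex measure \<Rightarrow> real \<Rightarrow> nat \<Rightarrow> complex \<Rightarrow> ennreal" where
  "survival M R 0 z = indicator (cball 0 R) z"
| "survival M R (Suc n) z = (\<integral>\<^sup>+ c. survival M R n (fq c z) \<partial>M)"

lemma measurable_fq [measurable]:
  assumes [measurable]: "f \<in> borel_measurable N" "g \<in> borel_measurable N"
  shows "(\<lambda>x. fq (f x) (g x)) \<in> borel_measurable N"
  unfolding fq_def by measurable

lemma measurable_survival:
  assumes "sigma_finite_measure M" and [measurable_cong]: "sets M = sets borel"
  shows "survival M R n \<in> borel_measurable borel"
proof (induction n)
  case 0
  have "indicator (cball 0 R) \<in> borel_measurable (borel :: complex measure)"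
    by (intro borel_measurable_indicator borel_closed closed_cball)
  then show ?case by (simp cong: measurable_cong)
next
  case (Suc n)
  note [measurable] = Suc
  interpret sigma_finite_measure M by fact
  have "(\<lambda>z. \<integral>\<^sup>+ c. survival M R n (fq c z) \<partial>M) \<in> borel_measurable borel"
    by measurable
  then show ?case by (simp add: fun_eq_iff[symmetric] cong: measurable_cong)
qed

lemma measurable_seq_iter [measurable]:
  assumes [measurable_cong]: "sets M = sets borel"
  shows "(\<lambda>\<omega>. seq_iter \<omega> n z) \<in> borel_measurable (PiM UNIV (\<lambda>_::nat. M))"
proof (induction n)
  case (Suc n)
  note [measurable] = Suc
  have "(\<lambda>\<omega>. fq (\<omega> n) (seq_iter \<omega> n z)) \<in> borel_measurable (PiM UNIV (\<lambda>_::nat. M))"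
    by measurable
  then show ?case by simp
qed simp

lemma measurable_seq_iter_shiftseq [measurable]:
  assumes [measurable_cong]: "sets M = sets borel"
  shows "(\<lambda>\<omega>. seq_iter (shiftseq j \<omega>) n z) \<in> borel_measurable (PiM UNIV (\<lambda>_::nat. M))"
proof (induction n)
  case (Suc n)
  note [measurable] = Suc
  have "(\<lambda>\<omega>. fq (\<omega> (j + n)) (seq_iter (shiftseq j \<omega>) n z)) \<in> borel_measurable (PiM UNIV (\<lambda>_::nat. M))"
    by measurable
  moreover have "seq_iter (shiftseq j \<omega>) (Suc n) z = fq (\<omega> (j + n)) (seq_iter (shiftseq j \<omega>) n z)" for \<omega>
    by (simp add: shiftseq_apply)
  ultimately show ?case by (simp only:)
qed simp

text \<open>The product measure is the law of one independent coordinate put in front of a sequence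
  with the same law, which matches the recursion of \<open>survival\<close>.\<close>

lemma nn_integral_seq_iter:
  assumes "prob_space M" and [measurable_cong]: "sets M = sets borel"
  shows "(\<integral>\<^sup>+ \<omega>. indicator (cball 0 R) (seq_iter \<omega> n z) \<partial>PiM UNIV (\<lambda>_::nat. M)) = survival M R n z"
proof (induction n arbitrary: z)
  case 0
  interpret P: prob_space "PiM UNIV (\<lambda>_::nat. M)" by (intro prob_space_PiM assms)
  show ?case by (simp add: P.emeasure_space_1)
next
  case (Suc n)
  interpret prob_space M by fact
  interpret sequence_space M by unfold_locales
  note [measurable] = measurable_seq_iter[OF assms(2)]
  let ?I = "\<lambda>w. indicator (cball 0 R) w :: ennreal"
  have eq: "seq_iter (case_nat s \<omega>) (Suc n) z = seq_iter \<omega> n (fq s z)" for s \<omega>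
    unfolding seq_iter_Suc_shift by (simp add: shiftseq_def)
  have mI: "(\<lambda>\<omega>. ?I (seq_iter \<omega> (Suc n) z)) \<in> borel_measurable S"
    by (rule measurable_compose[OF measurable_seq_iter[OF assms(2)]])
       (intro borel_measurable_indicator borel_closed closed_cball)
  have "(\<integral>\<^sup>+ \<omega>. ?I (seq_iter \<omega> (Suc n) z) \<partial>S)
      = (\<integral>\<^sup>+ \<omega>. ?I (seq_iter \<omega> (Suc n) z) \<partial>distr (M \<Otimes>\<^sub>M S) S (\<lambda>(s, \<omega>). case_nat s \<omega>))"
    by (simp only: PiM_iter)
  also have "\<dots> = (\<integral>\<^sup>+ x. ?I (seq_iter (case_nat (fst x) (snd x)) (Suc n) z) \<partial>(M \<Otimes>\<^sub>M S))"
    by (subst nn_integral_distr) (use mI in \<open>simp_all add: split_beta' del: seq_iter.simps\<close>)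
  also have "\<dots> = (\<integral>\<^sup>+ s. \<integral>\<^sup>+ \<omega>. ?I (seq_iter (case_nat s \<omega>) (Suc n) z) \<partial>S \<partial>M)"
    by (subst P.nn_integral_fst[symmetric])
       (use measurable_compose[OF _ mI, of "\<lambda>x. case_nat (fst x) (snd x)" "M \<Otimes>\<^sub>M S"] in
         \<open>simp_all del: seq_iter.simps\<close>)
  also have "\<dots> = (\<integral>\<^sup>+ s. survival M R n (fq s z) \<partial>M)"
    unfolding eq Suc ..
  finally show ?case by simp
qed

text \<open>The product measure is shift invariant, so critical points entering at any time
  \<open>j\<close> obey the same law.\<close>

lemma emeasure_survive:
  assumes "prob_space M" and [measurable_cong]: "sets M = sets borel"
  shows "emeasure (PiM UNIV (\<lambda>_::nat. M))
      {\<omega> \<in> space (PiM UNIV (\<lambda>_::nat. M)). cmod (seq_iter (shiftseq j \<omega>) n z) \<le> R} = survival M R n z"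
proof -
  let ?S = "PiM UNIV (\<lambda>_::nat. M)"
  let ?A = "{\<omega> \<in> space ?S. cmod (seq_iter \<omega> n z) \<le> R}"
  note [measurable] = measurable_seq_iter[OF assms(2)]
  have meas: "(\<lambda>\<omega>. shiftseq j \<omega>) \<in> measurable ?S ?S"
    unfolding shiftseq_def by (rule measurable_PiM_single') (auto simp: space_PiM)
  have "distr ?S ?S (\<lambda>\<omega>. shiftseq j \<omega>) = ?S"
    using distr_PiM_reindex[of UNIV "\<lambda>_. M" "\<lambda>i. j + i" UNIV] assms(1)
    by (simp add: shiftseq_def restrict_UNIV)
  then have "emeasure ?S ?A = emeasure (distr ?S ?S (\<lambda>\<omega>. shiftseq j \<omega>)) ?A" by simp
  also have "\<dots> = emeasure ?S ((\<lambda>\<omega>. shiftseq j \<omega>) -` ?A \<inter> space ?S)"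
    by (rule emeasure_distr[OF meas]) measurable
  also have "(\<lambda>\<omega>. shiftseq j \<omega>) -` ?A \<inter> space ?S = {\<omega> \<in> space ?S. cmod (seq_iter (shiftseq j \<omega>) n z) \<le> R}"
    using measurable_space[OF meas] by auto
  finally have "emeasure ?S {\<omega> \<in> space ?S. cmod (seq_iter (shiftseq j \<omega>) n z) \<le> R} = emeasure ?S ?A" ..
  also have "\<dots> = (\<integral>\<^sup>+ \<omega>. indicator ?A \<omega> \<partial>?S)" by (rule nn_integral_indicator[symmetric]) measurable
  also have "\<dots> = (\<integral>\<^sup>+ \<omega>. indicator (cball 0 R) (seq_iter \<omega> n z) \<partial>?S)"
    by (intro nn_integral_cong) (auto simp: indicator_def)
  also have "\<dots> = survival M R n z" by (rule nn_integral_seq_iter[OF assms])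
  finally show ?thesis .
qed

section \<open>Geometric decay of survival probabilities under uniform noise\<close>

locale noise =
  fixes c :: complex and r R :: real
  assumes r: "r > 0" and R: "R = cmod c + r + 2"
begin

abbreviation "\<mu> \<equiv> mu c r"
abbreviation "u \<equiv> survival \<mu> R"

sublocale \<mu>: prob_space \<mu> by (rule prob_space_mu[OF r])

lemma u_measurable [measurable]: "u n \<in> borel_measurable borel"
  by (rule measurable_survival) (unfold_locales, simp)

lemma u_outside: "cmod z > R \<Longrightarrow> u n z = 0"
proof (induction n arbitrary: z)
  case (Suc n)
  have "AE c' in \<mu>. u n (fq c' z) = 0"
    using AE_mu_cball[OF r]
  proof eventually_elim
    case (elim c')
    then have "cmod (c' - c) \<le> r" by (simp add: dist_norm norm_minus_commute)
    then have "cmod c' + 2 \<le> R" using norm_triangle_sub[of c' c] R by simp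
    from fq_escape[OF this, of z] Suc.prems have "cmod (fq c' z) > R" using R r norm_ge_zero[of c] by linarith
    then show ?case by (rule Suc.IH)
  qed
  then show ?case by (simp add: nn_integral_0_iff_AE)
qed simp

lemma u_le_1: "u n z \<le> 1"
proof (induction n arbitrary: z)
  case (Suc n)
  have "(\<integral>\<^sup>+ c'. u n (fq c' z) \<partial>\<mu>) \<le> (\<integral>\<^sup>+ c'. 1 \<partial>\<mu>)" by (intro nn_integral_mono Suc)
  then show ?case using \<mu>.emeasure_space_1 by simp
qed (simp add: indicator_def)

text \<open>Markov property: after surviving \<open>k\<close> steps, the orbit survives
  \<open>N\<close> further ones with probability at most \<open>q\<close>, wherever it is.\<close>

lemma u_scale:
  assumes "\<And>z. u N z \<le> q"
  shows "u (N + k) z \<le> q * u k z"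
proof (induction k arbitrary: z)
  \<comment> \<open>Here \<open>u 0 z\<close> is the indicator of the disc, so outside it the left
    side has to vanish, which is \<open>u_outside\<close>.\<close>
  case 0
  show ?case using assms[of z] u_outside[of z N] by (cases "cmod z \<le> R") auto
next
  case (Suc k)
  have "(\<integral>\<^sup>+ c'. u (N + k) (fq c' z) \<partial>\<mu>) \<le> (\<integral>\<^sup>+ c'. q * u k (fq c' z) \<partial>\<mu>)"
    by (intro nn_integral_mono Suc)
  also have "\<dots> = q * (\<integral>\<^sup>+ c'. u k (fq c' z) \<partial>\<mu>)"
    by (rule nn_integral_cmult) measurable
  finally show ?case by simp
qed

lemma u_antimono: "m \<le> n \<Longrightarrow> u n z \<le> u m z"
  using u_scale[of "n - m" 1 m z] u_le_1 by simp

text \<open>Escape persists for nearby points and parameters. A ball of first parameters with mass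
  \<open>p > 0\<close> leads to survival at most \<open>q\<close>; bounding the rest by 1 gives
  \<open>q * p + (1 - p) < 1\<close>.\<close>

lemma u_local_bound:
  assumes "\<omega> \<in> Omega c r" "cmod (seq_iter \<omega> n z) > R"
  shows "\<exists>q::real. 0 \<le> q \<and> q < 1 \<and> (\<exists>\<delta>>0. \<forall>z'\<in>ball z \<delta>. u n z' \<le> ennreal q)"
  using assms
proof (induction n arbitrary: \<omega> z)
  case 0
  have "open (- cball (0::complex) R)" by auto
  moreover have "z \<in> - cball 0 R" using 0 by simp
  ultimately obtain \<delta> where "\<delta> > 0" "ball z \<delta> \<subseteq> - cball 0 R" unfolding open_contains_ball by blast
  then show ?case
    by (intro exI[of _ 0] conjI exI[of _ \<delta>]) (auto simp: indicator_def)
next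
  case (Suc n)
  let ?a = "\<omega> 0"
  have "cmod (seq_iter (shiftseq 1 \<omega>) n (fq ?a z)) > R" using Suc.prems(2) by (simp only: seq_iter_Suc_shift)
  from Suc.IH[OF shiftseq_Omega[OF Suc.prems(1)] this]
  obtain q \<delta> where q: "0 \<le> q" "q < 1" and \<delta>: "\<delta> > 0" "\<And>w. w \<in> ball (fq ?a z) \<delta> \<Longrightarrow> u n w \<le> ennreal q" by blast
  define B where "B = ball ?a (\<delta> / 2)"
  define p where "p = measure \<mu> B"
  have [measurable]: "B \<in> sets borel" by (simp add: B_def)
  have "emeasure \<mu> B > 0" unfolding B_def
    using Suc.prems(1) \<delta>(1) by (intro mu_ball_pos r) (auto simp: Omega_def)
  then have p: "p > 0" by (simp add: p_def \<mu>.emeasure_eq_measure)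
  have pc: "measure \<mu> (- B) = 1 - p"
    using \<mu>.prob_compl[of B] by (simp add: p_def Compl_eq_Diff_UNIV)
  have "p \<le> 1" by (simp add: p_def)
  have "isCont (\<lambda>z::complex. z^2) z" by (intro continuous_intros)
  then obtain \<epsilon> where \<epsilon>: "\<epsilon> > 0" "\<And>z'. dist z' z < \<epsilon> \<Longrightarrow> dist (z'^2) (z^2) < \<delta> / 2"
    unfolding continuous_at_eps_delta using \<delta>(1) half_gt_zero by blast
  have "u (Suc n) z' \<le> ennreal (q * p + (1 - p))" if z': "z' \<in> ball z \<epsilon>" for z'
  proof -
    have in_ball: "fq c' z' \<in> ball (fq ?a z) \<delta>" if "c' \<in> B" for c'
    proof -
      have "dist (fq ?a z) (fq c' z') \<le> dist (z'^2) (z^2) + dist ?a c'"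
        unfolding fq_def dist_norm using norm_triangle_ineq[of "z^2 - z'^2" "?a - c'"]
        by (simp add: algebra_simps norm_minus_commute)
      moreover have "dist (z'^2) (z^2) < \<delta> / 2" using z' by (intro \<epsilon>(2)) (simp add: dist_commute)
      ultimately show ?thesis using that by (simp add: B_def)
    qed
    have "u (Suc n) z' = (\<integral>\<^sup>+ c'. u n (fq c' z') \<partial>\<mu>)" by simp
    also have "\<dots> \<le> (\<integral>\<^sup>+ c'. ennreal q * indicator B c' + indicator (- B) c' \<partial>\<mu>)"
      using in_ball \<delta>(2) u_le_1 by (intro nn_integral_mono) (auto simp: indicator_def)
    also have "\<dots> = ennreal q * emeasure \<mu> B + emeasure \<mu> (- B)"
      by (subst nn_integral_add) (auto simp: nn_integral_cmult)
    also have "\<dots> = ennreal (q * p + (1 - p))"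
      using q \<open>p \<le> 1\<close> p by (simp add: \<mu>.emeasure_eq_measure pc ennreal_mult'' flip: p_def)
    finally show ?thesis .
  qed
  moreover have "q * p + (1 - p) < 1"
  proof -
    have "q * p < 1 * p" using p q by (intro mult_strict_right_mono) auto
    then show ?thesis by simp
  qed
  moreover have "0 \<le> q * p + (1 - p)" using q p \<open>p \<le> 1\<close> by simp
  ultimately show ?case using \<epsilon>(1) by blast
qed

lemma u_uniform_bound:
  assumes esc: "\<And>z. \<exists>\<omega>\<in>Omega c r. \<exists>n. cmod (seq_iter \<omega> n z) > R"
  shows "\<exists>N q. N > 0 \<and> 0 < q \<and> q < 1 \<and> (\<forall>z. u N z \<le> ennreal q)"
proof -
  have "\<exists>n q \<delta>. 0 \<le> q \<and> q < 1 \<and> \<delta> > 0 \<and> (\<forall>z'\<in>ball z \<delta>. u n z' \<le> ennreal q)" for z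
    using esc[of z] u_local_bound by meson
  then obtain n q \<delta> where q: "\<And>z. 0 \<le> q z" "\<And>z. q z < 1" and \<delta>: "\<And>z. \<delta> z > 0"
    and nq: "\<And>z z'. z' \<in> ball z (\<delta> z) \<Longrightarrow> u (n z) z' \<le> ennreal (q z)" by metis
  obtain D where D: "finite D" "cball 0 R \<subseteq> (\<Union>z\<in>D. ball z (\<delta> z))"
  proof (rule compactE_image[of "cball 0 R" "cball 0 R" "\<lambda>z. ball z (\<delta> z)"])
    show "cball 0 R \<subseteq> (\<Union>z\<in>cball 0 R. ball z (\<delta> z))" using \<delta> by force
  qed auto
  \<comment> \<open>The sum dominates every \<open>n z\<close> of the finite subcover, and survival
    decreases in time. In \<open>Q\<close>, the entry \<open>1/2\<close> ensures positivity, so that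
    the \<open>N\<close>-th root and \<open>1 / q\<close> can be used later.\<close>
  define N where "N = Suc (\<Sum>z\<in>D. n z)"
  define Q where "Q = Max (insert (1/2) (q ` D))"
  have Q: "0 < Q" "Q < 1"
  proof -
    have "1/2 \<le> Q" unfolding Q_def using D(1) by (intro Max_ge) auto
    then show "0 < Q" by simp
    show "Q < 1" unfolding Q_def using D(1) q by (subst Max_less_iff) auto
  qed
  have "u N w \<le> ennreal Q" for w
  proof (cases "cmod w \<le> R")
    case True
    then obtain z where z: "z \<in> D" "w \<in> ball z (\<delta> z)" using D(2) by auto
    have "n z \<le> N" unfolding N_def using D(1) z(1) by (intro le_SucI member_le_sum) auto
    then have "u N w \<le> u (n z) w" by (rule u_antimono)
    also have "\<dots> \<le> ennreal (q z)" by (rule nq[OF z(2)])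
    also have "\<dots> \<le> ennreal Q" unfolding Q_def using D(1) z(1) by (intro ennreal_leI Max_ge) auto
    finally show ?thesis .
  next
    case False
    then show ?thesis using u_outside[of w N] by simp
  qed
  then show ?thesis using Q by (intro exI[of _ N] exI[of _ Q]) (simp add: N_def)
qed

lemma u_geometric:
  assumes esc: "\<And>z. \<exists>\<omega>\<in>Omega c r. \<exists>n. cmod (seq_iter \<omega> n z) > R"
  obtains C \<theta> :: real where "C > 0" "0 < \<theta>" "\<theta> < 1" "\<And>n z. u n z \<le> ennreal (C * \<theta> ^ n)"
proof -
  obtain N q where N: "N > 0" and q: "0 < q" "q < 1" and uN: "\<And>z. u N z \<le> ennreal q"
    using u_uniform_bound[OF esc] by blast
  have pw: "u (N * i) z \<le> ennreal (q ^ i)" for i z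
  proof (induction i)
    case (Suc i)
    have "u (N * Suc i) z \<le> ennreal q * u (N * i) z" using u_scale[OF uN, of "N * i" z] by simp
    also have "\<dots> \<le> ennreal q * ennreal (q ^ i)" by (intro mult_left_mono Suc) simp
    also have "\<dots> = ennreal (q ^ Suc i)" using q by (simp add: ennreal_mult)
    finally show ?case .
  qed (simp add: indicator_def)
  define \<theta> where "\<theta> = root N q"
  have \<theta>: "0 < \<theta>" "\<theta> < 1" "\<theta> ^ N = q" using N q by (simp_all add: \<theta>_def)
  have "u n z \<le> ennreal (1 / q * \<theta> ^ n)" for n z
  proof -
    have "u n z \<le> u (N * (n div N)) z" by (rule u_antimono) simp
    also have "\<dots> \<le> ennreal (q ^ (n div N))" by (rule pw)
    \<comment> \<open>Rounding \<open>n\<close> down to a multiple of \<open>N\<close> loses less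
      than one full block, that is, at most a factor \<open>1 / q\<close>.\<close>
    also have "q ^ (n div N) \<le> 1 / q * \<theta> ^ n"
    proof -
      have "n \<le> N * (n div N) + N" using N by (metis add_left_mono less_imp_le mod_less_divisor mult_div_mod_eq)
      then have "\<theta> ^ (N * (n div N) + N) \<le> \<theta> ^ n" using \<theta> by (intro power_decreasing) auto
      then show ?thesis using q by (simp add: power_add power_mult \<theta>(3) field_simps)
    qed
    then have "ennreal (q ^ (n div N)) \<le> ennreal (1 / q * \<theta> ^ n)" by (rule ennreal_leI)
    finally show ?thesis .
  qed
  then show ?thesis using that[of "1/q" \<theta>] q \<theta> by simp
qed

abbreviation "P \<equiv> PiM UNIV (\<lambda>_::nat. \<mu>)"

sublocale P: prob_space P by (intro prob_space_PiM \<mu>.prob_space_axioms)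

lemma emeasure_P_survive:
  "emeasure P {\<omega> \<in> space P. cmod (seq_iter (shiftseq j \<omega>) n z) \<le> R} = u n z"
  by (rule emeasure_survive[OF \<mu>.prob_space_axioms sets_mu])

lemma AE_Omega: "AE \<omega> in P. \<omega> \<in> Omega c r"
proof -
  have "AE \<omega> in P. \<omega> n \<in> cball c r" for n
    by (rule AE_PiM_component[where P="\<lambda>x. x \<in> cball c r"])
       (use \<mu>.prob_space_axioms AE_mu_cball[OF r] in auto)
  then have "AE \<omega> in P. \<forall>n. \<omega> n \<in> cball c r" by (simp only: AE_all_countable) blast
  then show ?thesis by (simp add: Omega_def)
qed

lemma le_geometric_imp_zero:
  fixes e :: ennreal
  assumes "\<And>n. e \<le> ennreal (C * \<theta> ^ n)" "0 < \<theta>" "\<theta> < 1"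
  shows "e = 0"
proof -
  have "(\<lambda>n. ennreal (C * \<theta> ^ n)) \<longlonglongrightarrow> ennreal (C * 0)"
    using assms(2,3) by (intro tendsto_ennrealI tendsto_mult tendsto_const LIMSEQ_power_zero) auto
  then have "e \<le> ennreal (C * 0)" by (rule LIMSEQ_le_const) (use assms(1) in blast)
  then show ?thesis by simp
qed

section \<open>Almost sure behaviour when every point can escape\<close>

context
  assumes esc: "\<And>z. \<exists>\<omega>\<in>Omega c r. \<exists>n. cmod (seq_iter \<omega> n z) > R"
begin

lemma AE_escape: "AE \<omega> in P. \<exists>n. R < cmod (seq_iter \<omega> n z)"
proof (rule AE_I)
  let ?B = "{\<omega> \<in> space P. \<forall>n. cmod (seq_iter \<omega> n z) \<le> R}"
  obtain C \<theta> :: real where C: "0 < \<theta>" "\<theta> < 1" "\<And>n z. u n z \<le> ennreal (C * \<theta> ^ n)"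
    using u_geometric[OF esc] by metis
  note [measurable] = measurable_seq_iter[OF sets_mu]
  show "{\<omega> \<in> space P. \<not> (\<exists>n. R < cmod (seq_iter \<omega> n z))} \<subseteq> ?B" by (auto simp: not_less)
  show "?B \<in> sets P" by measurable
  have "emeasure P ?B \<le> ennreal (C * \<theta> ^ n)" for n
  proof -
    have "emeasure P ?B \<le> emeasure P {\<omega> \<in> space P. cmod (seq_iter (shiftseq 0 \<omega>) n z) \<le> R}"
      unfolding shiftseq_0 by (rule emeasure_mono) (blast, measurable)
    also have "\<dots> \<le> ennreal (C * \<theta> ^ n)" unfolding emeasure_P_survive by (rule C)
    finally show ?thesis .
  qed
  then show "emeasure P ?B = 0" using C(1,2) by (rule le_geometric_imp_zero)
qed

text \<open>Almost surely all points of a countable dense set escape, and an open subset of the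
  filled set would contain one of them.\<close>

lemma AE_interior_filled_empty: "AE \<omega> in P. interior (filled R \<omega>) = {}"
proof -
  obtain D :: "complex set" where D: "countable D" "\<And>X. open X \<Longrightarrow> X \<noteq> {} \<Longrightarrow> \<exists>d\<in>D. d \<in> X"
    using countable_dense_exists[where 'a=complex] by blast
  have "AE \<omega> in P. \<forall>z\<in>D. \<exists>n. R < cmod (seq_iter \<omega> n z)"
    unfolding AE_ball_countable[OF D(1)] using AE_escape by blast
  then show ?thesis
  proof eventually_elim
    case (elim \<omega>)
    show ?case
    proof (rule ccontr)
      assume "interior (filled R \<omega>) \<noteq> {}"
      from D(2)[OF open_interior this] obtain d where d: "d \<in> D" "d \<in> filled R \<omega>"
        using interior_subset by blast
      then show False using elim by (auto simp: filled_def not_le[symmetric])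
    qed
  qed
qed

text \<open>The event \<open>E m k\<close> that some earlier critical point survives until
  \<open>k + m\<close> has, by the union bound, probability at most a geometric tail
  \<open>D m\<close>, uniformly in \<open>k\<close>. So \<open>E m k\<close> holds for all large
  \<open>k\<close> with probability at most \<open>D m\<close>, and \<open>D m\<close> tends to
  0.\<close>

lemma AE_critical_points_escape:
  "AE \<omega> in P. \<exists>m. \<exists>\<^sub>\<infinity>k. \<forall>j<k. R < cmod (seq_iter (shiftseq j \<omega>) (k + m - j) 0)"
proof (rule AE_I)
  obtain C \<theta> :: real where C: "C > 0" "0 < \<theta>" "\<theta> < 1" "\<And>n z. u n z \<le> ennreal (C * \<theta> ^ n)"
    using u_geometric[OF esc] by metis
  note [measurable] = measurable_seq_iter_shiftseq[OF sets_mu]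
  define X where "X j n = {\<omega> \<in> space P. cmod (seq_iter (shiftseq j \<omega>) n 0) \<le> R}" for j n
  define E where "E m k = (\<Union>j<k. X j (k + m - j))" for m k
  have X [measurable]: "X j n \<in> sets P" for j n unfolding X_def by measurable
  have E [measurable]: "E m k \<in> sets P" for m k unfolding E_def by measurable
  define D where "D m = C * \<theta> / (1 - \<theta>) * \<theta> ^ m" for m
  have PE: "emeasure P (E m k) \<le> ennreal (D m)" for m k
  proof -
    have "emeasure P (E m k) \<le> (\<Sum>j<k. emeasure P (X j (k + m - j)))"
      unfolding E_def by (rule emeasure_subadditive_finite) auto
    also have "\<dots> = (\<Sum>j<k. u (k + m - j) 0)" unfolding X_def emeasure_P_survive ..
    also have "\<dots> \<le> (\<Sum>j<k. ennreal (C * \<theta> ^ (k + m - j)))" by (intro sum_mono C)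
    also have "\<dots> = ennreal (\<Sum>j<k. C * \<theta> ^ (k + m - j))" using C by (intro sum_ennreal) auto
    \<comment> \<open>The latest critical point, \<open>j = k - 1\<close>, has had
      \<open>m + 1\<close> steps; reversing the order turns the sum into a geometric one starting at
      that exponent.\<close>
    also have "(\<Sum>j<k. C * \<theta> ^ (k + m - j)) = (\<Sum>j<k. C * \<theta> ^ (Suc (k - Suc j) + m))"
    proof (rule sum.cong)
      fix j assume "j \<in> {..<k}"
      then have "k + m - j = Suc (k - Suc j) + m" by simp
      then show "C * \<theta> ^ (k + m - j) = C * \<theta> ^ (Suc (k - Suc j) + m)" by (simp only:)
    qed simp
    also have "\<dots> = (\<Sum>i<k. C * \<theta> ^ (Suc i + m))" by (rule sum.nat_diff_reindex)
    also have "\<dots> = C * \<theta> * \<theta> ^ m * (\<Sum>i<k. \<theta> ^ i)"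
      by (simp add: sum_distrib_left power_add mult_ac)
    also have "\<dots> \<le> C * \<theta> * \<theta> ^ m * (1 / (1 - \<theta>))"
    proof (rule mult_left_mono)
      have "(\<Sum>i<k. \<theta> ^ i) = (1 - \<theta> ^ k) / (1 - \<theta>)" using C by (simp add: sum_gp_strict)
      also have "\<dots> \<le> 1 / (1 - \<theta>)" using C by (intro divide_right_mono) auto
      finally show "(\<Sum>i<k. \<theta> ^ i) \<le> 1 / (1 - \<theta>)" .
    qed (use C in auto)
    finally show ?thesis by (simp add: D_def ennreal_leI mult_ac)
  qed
  \<comment> \<open>\<open>B m\<close> is the lower limit of the bad events. Its complement says
    that infinitely many \<open>k\<close> are good for this \<open>m\<close>.\<close>
  define F where "F m K = (\<Inter>k\<in>{K..}. E m k)" for m K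
  define B where "B m = (\<Union>K. F m K)" for m
  have F [measurable]: "F m K \<in> sets P" for m K
    unfolding F_def by (rule sets.countable_INT') (auto simp: E)
  have B [measurable]: "B m \<in> sets P" for m unfolding B_def by measurable
  have PB: "emeasure P (B m) \<le> ennreal (D m)" for m
  proof -
    have "incseq (F m)" by (auto simp: F_def incseq_def)
    then have "emeasure P (B m) = (SUP K. emeasure P (F m K))"
      unfolding B_def by (intro SUP_emeasure_incseq[symmetric]) auto
    also have "\<dots> \<le> ennreal (D m)"
    proof (rule SUP_least)
      fix K
      have "emeasure P (F m K) \<le> emeasure P (E m K)" by (rule emeasure_mono) (auto simp: F_def)
      also have "\<dots> \<le> ennreal (D m)" by (rule PE)
      finally show "emeasure P (F m K) \<le> ennreal (D m)" .
    qed
    finally show ?thesis .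
  qed
  show "(\<Inter>m. B m) \<in> sets P" by measurable
  have "emeasure P (\<Inter>m. B m) \<le> ennreal (C * \<theta> / (1 - \<theta>) * \<theta> ^ m)" for m
  proof -
    have "emeasure P (\<Inter>m. B m) \<le> emeasure P (B m)" by (rule emeasure_mono) auto
    with PB[of m] show ?thesis by (simp add: D_def)
  qed
  then show "emeasure P (\<Inter>m. B m) = 0" using C(2,3) by (rule le_geometric_imp_zero)
  show "{\<omega> \<in> space P. \<not> (\<exists>m. \<exists>\<^sub>\<infinity>k. \<forall>j<k. R < cmod (seq_iter (shiftseq j \<omega>) (k + m - j) 0))} \<subseteq> (\<Inter>m. B m)"
  proof (intro subsetI INT_I)
    fix \<omega> m assume "\<omega> \<in> {\<omega> \<in> space P. \<not> (\<exists>m. \<exists>\<^sub>\<infinity>k. \<forall>j<k. R < cmod (seq_iter (shiftseq j \<omega>) (k + m - j) 0))}"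
    then have \<omega>: "\<omega> \<in> space P" "\<forall>\<^sub>\<infinity>k. \<exists>j<k. cmod (seq_iter (shiftseq j \<omega>) (k + m - j) 0) \<le> R"
      by (auto simp: not_frequently not_less)
    then obtain K where "\<And>k. k \<ge> K \<Longrightarrow> \<exists>j<k. cmod (seq_iter (shiftseq j \<omega>) (k + m - j) 0) \<le> R"
      unfolding MOST_nat_le by blast
    then have "\<omega> \<in> F m K" using \<omega>(1) by (auto simp: F_def E_def X_def)
    then show "\<omega> \<in> B m" by (auto simp: B_def)
  qed
qed

lemma AE_julia_totally_disconnected: "AE \<omega> in P. totally_disconnected (julia \<omega>)"
  using AE_Omega AE_interior_filled_empty AE_critical_points_escape
proof eventually_elim
  case (elim \<omega>)
  then show ?case using julia_totally_disconnected Omega_admissible R by blast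
qed

end

end

subsection \<open>The bifurcation radius\<close>

lemma closure_invariant:
  assumes "\<And>c'. c' \<in> B \<Longrightarrow> fq c' ` A \<subseteq> A" "c' \<in> B"
  shows "fq c' ` closure A \<subseteq> closure A"
proof -
  have "fq c' ` closure A \<subseteq> closure (fq c' ` A)"
    by (intro image_closure_subset closed_closure closure_subset) (auto simp: fq_def intro!: continuous_intros)
  also have "\<dots> \<subseteq> closure A" by (intro closure_mono assms)
  finally show ?thesis .
qed

lemma Gsg_orbit_invariant:
  assumes "c' \<in> cball c r"
  shows "fq c' ` (\<Union>g\<in>Gsg c r. {g z}) \<subseteq> (\<Union>g\<in>Gsg c r. {g z})"
proof safe
  fix g assume "g \<in> Gsg c r"
  then have "fq c' \<circ> g \<in> Gsg c r" using assms by (intro Gsg.comp Gsg.gen)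
  then show "fq c' (g z) \<in> (\<Union>g\<in>Gsg c r. {g z})"
    by (intro UN_I[of "fq c' \<circ> g"]) auto
qed

text \<open>A root of \<open>z^2 - z + c\<close> is fixed by the only generator at radius 0. Hence
  the supremum in \<open>r_bif\<close> is over a nonempty set.\<close>

lemma planar_minimal_set_fixed_point: "\<exists>L. planar_minimal_set (Gsg c 0) L"
proof -
  define z where "z = (1 + csqrt (1 - 4 * c)) / 2"
  have "2 * z - 1 = csqrt (1 - 4 * c)" by (simp add: z_def field_simps)
  then have "(2 * z - 1)^2 = 1 - 4 * c" by simp
  then have "4 * (z^2 + c) = 4 * z" by (simp add: power2_eq_square algebra_simps)
  then have z: "fq c z = z" unfolding fq_def by (simp only: mult_cancel_left) simp
  have "planar_minimal_set (Gsg c 0) {z}"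
    unfolding planar_minimal_set_def Gsg_invariant_iff using z by auto
  then show ?thesis ..
qed

text \<open>Makes the supremum in \<open>r_bif\<close> finite. Moving the parameter by
  \<open>r\<close> in the direction of \<open>z^2\<close>, for \<open>z\<close> in \<open>L\<close>
  of largest modulus, gives \<open>cmod z ^ 2 + r - cmod c \<le> cmod z\<close>, and
  \<open>cmod z \<le> cmod z ^ 2 + 1\<close>.\<close>

lemma planar_minimal_set_radius_le:
  assumes "planar_minimal_set (Gsg c r) L" "r \<ge> 0"
  shows "r \<le> cmod c + 1"
proof -
  from assms have L: "L \<noteq> {}" "compact L" "\<And>c'. c' \<in> cball c r \<Longrightarrow> fq c' ` L \<subseteq> L"
    unfolding planar_minimal_set_def Gsg_invariant_iff by auto
  obtain z where z: "z \<in> L" "\<And>w. w \<in> L \<Longrightarrow> cmod w \<le> cmod z"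
    using continuous_attains_sup[OF L(2,1), of cmod] continuous_on_norm_id by blast
  define e where "e = (if z = 0 then 1 else sgn (z^2))"
  have e: "cmod e = 1" by (simp add: e_def norm_sgn)
  have "z^2 = of_real (cmod z ^ 2) * e"
    by (simp add: e_def sgn_div_norm scaleR_conv_of_real norm_power)
  then have "z^2 + of_real r * e = of_real (cmod z ^ 2 + r) * e" by (simp add: algebra_simps)
  then have n: "cmod (z^2 + of_real r * e) = cmod z ^ 2 + r"
    using e assms(2) by (simp only: norm_mult norm_of_real) simp
  have "c + of_real r * e \<in> cball c r" using e assms(2) by (simp add: dist_norm norm_mult)
  then have "fq (c + of_real r * e) z \<in> L" using L(3) z(1) by blast
  then have "cmod (fq (c + of_real r * e) z) \<le> cmod z" by (rule z(2))
  moreover have "cmod (z^2 + of_real r * e) - cmod c \<le> cmod (fq (c + of_real r * e) z)"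
    unfolding fq_def using norm_diff_ineq[of "z^2 + of_real r * e" c] by (simp add: algebra_simps)
  ultimately have "cmod z ^ 2 + r \<le> cmod z + cmod c" using n by simp
  moreover have "cmod z \<le> cmod z ^ 2 + 1" using zero_le_power2[of "cmod z - 1/2"]
    by (simp add: power2_eq_square algebra_simps)
  ultimately show ?thesis by simp
qed

lemma bdd_above_planar_radii: "bdd_above {r. r \<ge> 0 \<and> (\<exists>L. planar_minimal_set (Gsg c r) L)}"
  using planar_minimal_set_radius_le by (intro bdd_aboveI[of _ "cmod c + 1"]) blast

lemma Omega_mono: "r \<le> r' \<Longrightarrow> Omega c r \<subseteq> Omega c r'"
  by (auto simp: Omega_def intro: order_trans)

text \<open>Every smaller radius \<open>r'\<close> close to \<open>r\<close> admits an invariant compact set, which contains the critical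
  point. A noise sequence for \<open>r\<close> is the limit of its contractions towards \<open>c\<close>.\<close>

lemma le_r_bif_imp_bounded:
  assumes "superattracting ct" "ct \<in> ball c r" "r \<le> r_bif c" and \<omega>: "\<omega> \<in> Omega c r"
  shows "cmod (seq_iter \<omega> n 0) \<le> cmod c + r + 2"
proof -
  let ?R = "cmod c + r + 2"
  have r: "r > 0" using assms(2) by (metis ball_empty empty_iff not_le)
  \<comment> \<open>Some radius \<open>s > r'\<close> has a minimal set. Since
    \<open>dist c ct < r'\<close>, the superattracting parameter is still inside the disc of radius
    \<open>s\<close>, so the minimal set contains 0.\<close>
  have small: "cmod (seq_iter \<omega>' n 0) \<le> ?R" if r': "dist c ct < r'" "r' < r" "\<omega>' \<in> Omega c r'" for r' \<omega>'
  proof -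
    have "r' < Sup {r. r \<ge> 0 \<and> (\<exists>L. planar_minimal_set (Gsg c r) L)}"
      using r' assms(3) by (simp add: r_bif_def)
    then obtain s L where s: "r' < s" "planar_minimal_set (Gsg c s) L"
      using less_cSup_iff[OF _ bdd_above_planar_radii, of c r'] planar_minimal_set_fixed_point[of c] by auto
    from s have L: "L \<noteq> {}" "compact L" "\<And>c'. c' \<in> cball c s \<Longrightarrow> fq c' ` L \<subseteq> L"
      unfolding planar_minimal_set_def Gsg_invariant_iff by auto
    have "0 \<in> L" by (rule invariant_compact_contains_zero[OF assms(1) _ L(2,1,3)]) (use r' s in auto)
    have "\<omega>' \<in> Omega c s" using Omega_mono[of r' s c] s r'(3) by auto
    then have "seq_iter \<omega>' k 0 \<in> L" for k using \<open>0 \<in> L\<close> L(3) by (intro seq_iter_invariant[of c s]) auto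
    then have "range (\<lambda>k. seq_iter \<omega>' (Suc k) 0) \<subseteq> L" by blast
    then have "bounded (range (\<lambda>k. seq_iter \<omega>' (Suc k) 0))"
      using compact_imp_bounded[OF L(2)] bounded_subset by blast
    moreover have "admissible ?R \<omega>'"
      using Omega_mono[of r' r c] r' by (intro Omega_admissible) auto
    ultimately show ?thesis using seq_iter_bounded_iff by blast
  qed
  define w where "w t = (\<lambda>i. c + of_real t * (\<omega> i - c))" for t :: real
  have w: "w t \<in> Omega c (t * r)" if "t \<ge> 0" for t
    using \<omega> that unfolding Omega_def w_def
    by (auto simp: dist_norm norm_mult norm_minus_commute intro!: mult_left_mono)
  have cont: "continuous_on UNIV (\<lambda>t. cmod (seq_iter (w t) n 0))"
    unfolding w_def by (intro continuous_intros)
  then have "(\<lambda>t. cmod (seq_iter (w t) n 0)) \<midarrow>1\<rightarrow> cmod (seq_iter (w 1) n 0)"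
    by (simp add: continuous_on_eq_continuous_at isCont_def)
  then have lim: "((\<lambda>t. cmod (seq_iter (w t) n 0)) \<longlongrightarrow> cmod (seq_iter (w 1) n 0)) (at_left 1)"
    by (rule filterlim_mono) (auto intro: at_le)
  have "dist c ct / r < 1" using assms(2) r by simp
  \<comment> \<open>For these \<open>t\<close> the contracted radius \<open>t * r\<close> lies
    strictly between \<open>dist c ct\<close> and \<open>r\<close>, as \<open>small\<close>
    requires.\<close>
  then have "\<forall>\<^sub>F t in at_left 1. t \<in> {dist c ct / r<..<1}"
    by (rule eventually_at_left_real)
  then have "\<forall>\<^sub>F t in at_left 1. cmod (seq_iter (w t) n 0) \<le> ?R"
  proof eventually_elim
    case (elim t)
    then have t: "dist c ct < t * r" "t < 1" using r by (auto simp: field_simps)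
    moreover have "0 \<le> dist c ct / r" using r by simp
    then have "t \<ge> 0" using elim by auto
    ultimately show ?case using w[of t] r by (intro small[of "t * r"]) auto
  qed
  then have "cmod (seq_iter (w 1) n 0) \<le> ?R" by (intro tendsto_upperbound[OF lim]) auto
  then show ?thesis by (simp add: w_def)
qed

text \<open>Minimality: every nonempty compact invariant subset contains 0, hence its whole orbit
  and the closure of that orbit.\<close>

lemma bounded_imp_planar_minimal_set:
  assumes ct: "superattracting ct" "ct \<in> ball c r"
    and bd: "bounded (\<Union>g\<in>Gsg c r. {g 0})"
  shows "planar_minimal_set (Gsg c r) (closure (\<Union>g\<in>Gsg c r. {g 0}))"
proof -
  let ?A = "\<Union>g\<in>Gsg c r. {g 0}"
  have "r > 0" using ct(2) by (metis ball_empty empty_iff not_le)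
  then have "fq c \<in> Gsg c r" by (intro Gsg.gen) auto
  then have ne: "closure ?A \<noteq> {}" by auto
  have cpt: "compact (closure ?A)" using bd by (simp add: compact_closure)
  have inv: "fq c' ` closure ?A \<subseteq> closure ?A" if "c' \<in> cball c r" for c'
    by (rule closure_invariant[of "cball c r", OF Gsg_orbit_invariant that])
  have "K = closure ?A"
    if K: "K \<subseteq> closure ?A" "K \<noteq> {}" "compact K" "\<forall>c'\<in>cball c r. fq c' ` K \<subseteq> K" for K
  proof -
    have "0 \<in> K" by (rule invariant_compact_contains_zero[OF ct K(3,2)]) (use K(4) in blast)
    moreover have "\<forall>g\<in>Gsg c r. g ` K \<subseteq> K" using K(4) Gsg_invariant_iff by blast
    ultimately have "?A \<subseteq> K" by blast
    then have "closure ?A \<subseteq> K" using compact_imp_closed[OF K(3)] closure_minimal by blast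
    with K(1) show ?thesis by blast
  qed
  then show ?thesis
    unfolding planar_minimal_set_def Gsg_invariant_iff using ne cpt inv by blast
qed

lemma bounded_orbits_iff:
  "bounded (\<Union>g\<in>Gsg c r. {g 0}) \<longleftrightarrow>
    (\<forall>\<omega>\<in>Omega c r. \<forall>n. cmod (seq_iter \<omega> n 0) \<le> cmod c + r + 2)"
proof
  assume bd: "bounded (\<Union>g\<in>Gsg c r. {g 0})"
  show "\<forall>\<omega>\<in>Omega c r. \<forall>n. cmod (seq_iter \<omega> n 0) \<le> cmod c + r + 2"
  proof
    fix \<omega> assume \<omega>: "\<omega> \<in> Omega c r"
    have "range (\<lambda>n. seq_iter \<omega> (Suc n) 0) \<subseteq> (\<Union>g\<in>Gsg c r. {g 0})"
      unfolding Gsg_orbit_eq using \<omega> by blast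
    then have "bounded (range (\<lambda>n. seq_iter \<omega> (Suc n) 0))" using bd bounded_subset by blast
    then show "\<forall>n. cmod (seq_iter \<omega> n 0) \<le> cmod c + r + 2"
      using seq_iter_bounded_iff[OF Omega_admissible[OF \<omega>]] by blast
  qed
next
  assume "\<forall>\<omega>\<in>Omega c r. \<forall>n. cmod (seq_iter \<omega> n 0) \<le> cmod c + r + 2"
  then show "bounded (\<Union>g\<in>Gsg c r. {g 0})"
    unfolding Gsg_orbit_eq bounded_iff by blast
qed

text \<open>If no orbit of \<open>z\<close> left the disc, the closure of its semigroup orbit would
  be compact and invariant, hence contain 0 and the orbit of 0, which would then be bounded.\<close>

lemma unbounded_imp_all_escape:
  assumes ct: "superattracting ct" "ct \<in> ball c r"
    and unb: "\<not> bounded (\<Union>g\<in>Gsg c r. {g 0})"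
  shows "\<exists>\<omega>\<in>Omega c r. \<exists>n. cmod (seq_iter \<omega> n z) > cmod c + r + 2"
proof (rule ccontr)
  assume neg: "\<not> ?thesis"
  let ?A = "\<Union>g\<in>Gsg c r. {g z}"
  have "r > 0" using ct(2) by (metis ball_empty empty_iff not_le)
  then have "fq c \<in> Gsg c r" by (intro Gsg.gen) auto
  then have ne: "closure ?A \<noteq> {}" by auto
  have "bounded ?A" unfolding Gsg_orbit_eq bounded_iff using neg not_less by blast
  then have cpt: "compact (closure ?A)" by (simp add: compact_closure)
  have inv: "fq c' ` closure ?A \<subseteq> closure ?A" if "c' \<in> cball c r" for c'
    by (rule closure_invariant[of "cball c r", OF Gsg_orbit_invariant that])
  have "0 \<in> closure ?A" by (rule invariant_compact_contains_zero[OF ct cpt ne inv])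
  moreover have "\<forall>g\<in>Gsg c r. g ` closure ?A \<subseteq> closure ?A" using inv Gsg_invariant_iff by blast
  ultimately have "(\<Union>g\<in>Gsg c r. {g 0}) \<subseteq> closure ?A" by blast
  then show False using unb cpt compact_imp_bounded bounded_subset by blast
qed

section \<open>The two groups of equivalences\<close>

theorem theorem4p6:
  fixes c :: complex and r :: real
  assumes "r \<ge> 0"
    and "\<exists>ct \<in> interior (cball c r). superattracting ct"
  shows
   "((r \<le> r_bif c) \<longleftrightarrow> (\<forall>\<omega>\<in>Omega c r. bounded (range (\<lambda>n. seq_iter \<omega> (Suc n) 0))))
    \<and> ((\<forall>\<omega>\<in>Omega c r. bounded (range (\<lambda>n. seq_iter \<omega> (Suc n) 0)))
         \<longleftrightarrow> (\<forall>\<omega>\<in>Omega c r. connected (julia \<omega>)))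
    \<and> ((\<forall>\<omega>\<in>Omega c r. connected (julia \<omega>))
         \<longleftrightarrow> planar_minimal_set (Gsg c r) (closure (\<Union>g\<in>Gsg c r. {g 0})))
    \<and> ((r > r_bif c) \<longleftrightarrow>
         (AE \<omega> in Prob c r. filterlim (\<lambda>n. seq_iter \<omega> n 0) at_infinity sequentially))
    \<and> ((AE \<omega> in Prob c r. filterlim (\<lambda>n. seq_iter \<omega> n 0) at_infinity sequentially)
         \<longleftrightarrow> (AE \<omega> in Prob c r. totally_disconnected (julia \<omega>)))
    \<and> ((AE \<omega> in Prob c r. totally_disconnected (julia \<omega>))
         \<longleftrightarrow> \<not> bounded (closure (\<Union>g\<in>Gsg c r. {g 0})))
    \<and> ((r \<le> r_bif c
          \<and> (\<forall>\<omega>\<in>Omega c r. bounded (range (\<lambda>n. seq_iter \<omega> (Suc n) 0)))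
          \<and> (\<forall>\<omega>\<in>Omega c r. connected (julia \<omega>))
          \<and> planar_minimal_set (Gsg c r) (closure (\<Union>g\<in>Gsg c r. {g 0})))
       \<or> (r > r_bif c
          \<and> (AE \<omega> in Prob c r. filterlim (\<lambda>n. seq_iter \<omega> n 0) at_infinity sequentially)
          \<and> (AE \<omega> in Prob c r. totally_disconnected (julia \<omega>))
          \<and> \<not> bounded (closure (\<Union>g\<in>Gsg c r. {g 0}))))"
proof -
  obtain ct where ct: "superattracting ct" "ct \<in> ball c r" using assms(2) by auto
  have r: "r > 0" using ct(2) by (metis ball_empty empty_iff not_le)
  define R where "R = cmod c + r + 2"
  interpret noise c r R by unfold_locales (auto simp: r R_def)
  let ?A = "\<Union>g\<in>Gsg c r. {g 0}"
  \<comment> \<open>Every statement of the first group is shown equivalent to \<open>?X\<close>,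
    every statement of the second group to its negation.\<close>
  let ?X = "bounded ?A"
  let ?esc = "AE \<omega> in Prob c r. filterlim (\<lambda>n. seq_iter \<omega> n 0) at_infinity sequentially"
  let ?td = "AE \<omega> in Prob c r. totally_disconnected (julia \<omega>)"
  have adm: "admissible R \<omega>" if "\<omega> \<in> Omega c r" for \<omega> unfolding R_def by (rule Omega_admissible[OF that])
  have X: "?X \<longleftrightarrow> (\<forall>\<omega>\<in>Omega c r. \<forall>n. cmod (seq_iter \<omega> n 0) \<le> R)"
    unfolding R_def by (rule bounded_orbits_iff)
  have X2: "?X \<longleftrightarrow> (\<forall>\<omega>\<in>Omega c r. bounded (range (\<lambda>n. seq_iter \<omega> (Suc n) 0)))"
    unfolding X using seq_iter_bounded_iff[OF adm] by blast
  have "r \<le> r_bif c" if "planar_minimal_set (Gsg c r) L" for L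
    unfolding r_bif_def by (rule cSup_upper[OF _ bdd_above_planar_radii]) (use that r in auto)
  \<comment> \<open>Boundedness gives a minimal set, a minimal set gives
    \<open>r \<le> r_bif c\<close>, and this gives boundedness again.\<close>
  then have X1: "?X \<longleftrightarrow> r \<le> r_bif c" and X4: "?X \<longleftrightarrow> planar_minimal_set (Gsg c r) (closure ?A)"
    using bounded_imp_planar_minimal_set[OF ct] le_r_bif_imp_bounded[OF ct] X unfolding R_def by blast+
  have conn: "\<forall>\<omega>\<in>Omega c r. connected (julia \<omega>)" if ?X
  proof
    fix \<omega> assume \<omega>: "\<omega> \<in> Omega c r"
    show "connected (julia \<omega>)"
      by (rule connected_julia[OF adm[OF \<omega>]]) (use that X shiftseq_Omega[OF \<omega>] in blast)
  qed
  \<comment> \<open>\<open>Omega c r\<close> has full measure in a probability space, so a property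
    failing on all of it cannot hold almost surely.\<close>
  have contra: False if "AE \<omega> in Prob c r. Q \<omega>" "\<And>\<omega>. \<omega> \<in> Omega c r \<Longrightarrow> \<not> Q \<omega>" for Q
  proof -
    have "AE \<omega> in P. False" using that(1)[unfolded Prob_def] AE_Omega by eventually_elim (use that(2) in blast)
    then show False by simp
  qed
  have Xesc: "\<not> ?esc" if ?X
  proof
    assume ?esc
    then show False
    proof (rule contra)
      fix \<omega> assume \<omega>: "\<omega> \<in> Omega c r"
      have le: "cmod (seq_iter \<omega> n 0) \<le> R" for n using that \<omega> X by blast
      show "\<not> filterlim (\<lambda>n. seq_iter \<omega> n 0) at_infinity sequentially"
      proof
        assume "filterlim (\<lambda>n. seq_iter \<omega> n 0) at_infinity sequentially"
        moreover have "R + 1 > 0" using r norm_ge_zero[of c] unfolding R_def by linarith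
        ultimately have "\<forall>\<^sub>F n in sequentially. R + 1 \<le> cmod (seq_iter \<omega> n 0)"
          unfolding filterlim_at_infinity[OF order_refl] by blast
        then obtain n where "R + 1 \<le> cmod (seq_iter \<omega> n 0)"
          using eventually_happens'[OF sequentially_bot] by blast
        then show False using le[of n] by simp
      qed
    qed
  qed
  have Xtd: "\<not> ?td" if ?X
    using contra[of "\<lambda>\<omega>. totally_disconnected (julia \<omega>)"]
      connected_julia_not_totally_disconnected[OF adm] conn[OF that] by blast
  have all: "\<exists>\<omega>\<in>Omega c r. \<exists>n. cmod (seq_iter \<omega> n z) > R" if "\<not> ?X" for z
    unfolding R_def by (rule unbounded_imp_all_escape[OF ct that])
  have nXesc: ?esc if "\<not> ?X"
    unfolding Prob_def using AE_Omega AE_escape[OF all[OF that], of 0]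
    by eventually_elim (use seq_iter_tendsto_infinity[OF adm] in blast)
  have nXtd: ?td if "\<not> ?X"
    unfolding Prob_def by (rule AE_julia_totally_disconnected[OF all[OF that]])
  have nXconn: "\<not> (\<forall>\<omega>\<in>Omega c r. connected (julia \<omega>))" if "\<not> ?X"
    using contra[OF nXtd[OF that]] connected_julia_not_totally_disconnected[OF adm] by blast
  have Xcl: "bounded (closure ?A) \<longleftrightarrow> ?X"
    using bounded_closure bounded_subset closure_subset by blast
  have X1': "r > r_bif c \<longleftrightarrow> \<not> ?X" using X1 by auto
  show ?thesis
  proof (cases ?X)
    case True
    then show ?thesis
      unfolding X1[symmetric] X2[symmetric] X4[symmetric] X1' Xcl using conn Xesc Xtd by simp
  next
    case False
    then show ?thesis
      unfolding X1[symmetric] X2[symmetric] X4[symmetric] X1' Xcl using nXconn nXesc nXtd by simp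
  qed
qed

end
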